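(* Let $0\le a<b<\infty$, $\Delta=[a,b]$, let $\Phi\in C^1(\Delta,\mathbb R)$ be increasing with $\Phi'(\ell)\neq 0$ for all $\ell\in\Delta$, let $0<\kappa<\mu\le 1$, $\omega>0$, $\mathfrak z_a\in\mathbb R$, and let $\mathbb F:\Delta\times\mathbb R\to\mathbb R$ be continuous. Consider the problem $$ (P)\qquad {}^c\mathbb D_{a^+}^{\mu;\Phi}\mathfrak z(\ell)+\omega\,{}^c\mathbb D_{a^+}^{\kappa;\Phi}\mathfrak z(\ell)=\mathbb F(\ell,\mathfrak z(\ell)),\quad \ell\in\Delta,\qquad \mathfrak z(a)=\mathfrak z_a. $$ Assume: (i) there exist $\mathfrak z_0,\tilde{\mathfrak z}_0\in C(\Delta,\mathbb R)$ which are respectively a lower and an upper solution of $(P)$, with $\mathfrak z_0(\ell)\le\tilde{\mathfrak z}_0(\ell)$ for $\ell\in\Delta$; (ii) $\mathbb F(\ell,x)\le\mathbb F(\ell,y)$ for every $\ell\in\Delta$ and all $x,y$ with $\mathfrak z_0(\ell)\le x\le y\le\tilde{\mathfrak z}_0(\ell)$. Then there exist monotone iterative sequences $\{\mathfrak z_n\}$ and $\{\tilde{\mathfrak z}_n\}$ (starting from $\mathfrak z_0$ and $\tilde{\mathfrak z}_0$) which converge uniformly on $\Delta$ to the extremal solutions of $(P)$ in the sector $$ [\mathfrak z_0,\tilde{\mathfrak z}_0]=\{\mathfrak z\in C(\Delta,\mathbb R):\ \mathfrak z_0(\ell)\le\mathfrak z(\ell)\le\tilde{\mathfrak z}_0(\ell),\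 \ell\in\Delta\} $$ (to the minimal and the maximal solution in the sector, respectively). Furthermore, if in addition there is a constant $M\ge 0$ such that $0\le \mathbb F(\ell,y)-\mathbb F(\ell,x)\le M(y-x)$ for all $\ell\in\Delta$ and all $x,y$ with $\mathfrak z_0(\ell)\le x\le y\le\tilde{\mathfrak z}_0(\ell)$, then $(P)$ has a unique solution in $[\mathfrak z_0,\tilde{\mathfrak z}_0]$.
   Context: For $\alpha>0$ and integrable $\mathfrak z:\Delta\to\mathbb R$, the $\Phi$-Riemann–Liouville integral is $\mathbb I_{a^+}^{\alpha;\Phi}\mathfrak z(\ell)=\frac1{\Gamma(\alpha)}\int_a^\ell\Phi'(\rho)(\Phi(\ell)-\Phi(\rho))^{\alpha-1}\mathfrak z(\rho)\,\mathrm d\rho$; $\mathbb I_{a^+}^{0;\Phi}$ is the identity. For $0<\alpha\le1$ and $\mathfrak z\in C^1(\Delta,\mathbb R)$, the $\Phi$-Caputo derivative is ${}^c\mathbb D_{a^+}^{\alpha;\Phi}\mathfrak z=\mathbb I_{a^+}^{1-\alpha;\Phi}\bigl(\mathfrak z'/\Phi'\bigr)$ (so for $\alpha=1$ it is $\mathfrak z'/\Phi'$). For $\mathfrak z$ that is only continuous, it is understood in the standard extended sense ${}^c\mathbb D_{a^+}^{\alpha;\Phi}\mathfrak z(\ell)=\frac{1}{\Phi'(\ell)}\frac{\mathrm d}{\mathrm d\ell}\,\mathbb I_{a^+}^{1-\alpha;\Phi}\bigl(\mathfrak z-\mathfrak z(a)\bigr)(\ell)$, which agrees with the previous formula for $C^1$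 functions; "${}^c\mathbb D_{a^+}^{\alpha;\Phi}\mathfrak z\in C(\Delta,\mathbb R)$" means that $\mathbb I_{a^+}^{1-\alpha;\Phi}(\mathfrak z-\mathfrak z(a))$ is continuously differentiable on $\Delta$ (one-sided at the endpoints). Solutions, lower solutions and upper solutions are functions $\mathfrak z\in C(\Delta,\mathbb R)$ with ${}^c\mathbb D_{a^+}^{\mu;\Phi}\mathfrak z,\ {}^c\mathbb D_{a^+}^{\kappa;\Phi}\mathfrak z\in C(\Delta,\mathbb R)$. A solution satisfies $(P)$. A lower solution satisfies ${}^c\mathbb D_{a^+}^{\mu;\Phi}\mathfrak z(\ell)+\omega\,{}^c\mathbb D_{a^+}^{\kappa;\Phi}\mathfrak z(\ell)\le\mathbb F(\ell,\mathfrak z(\ell))$ for $\ell\in\Delta$ and $\mathfrak z(a)\le\mathfrak z_a$; an upper solution satisfies both inequalities reversed. Iterative sequences: $\mathfrak z_{n+1}$ is the (unique) solution of the linear problem ${}^c\mathbb D_{a^+}^{\mu;\Phi}\mathfrak z_{n+1}(\ell)+\omega\,{}^c\mathbb D_{a^+}^{\kappa;\Phi}\mathfrak z_{n+1}(\ell)=\mathbb F(\ell,\mathfrak z_n(\ell))$ on $\Delta$, $\mathfrak z_{n+1}(a)=\mathfrak z_a$, for $n\ge0$; $\tilde{\mathfrak z}_{n+1}$ is defined in the same way from $\tilde{\mathfrak z}_n$. Equivalently, $\mathfrak z_{n+1}(\ell)=\mathfrak z_a+\int_a^\ell\Phi'(\rho)(\Phi(\ell)-\Phi(\rho))^{\mu-1}\mathbb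 E_{\mu-\kappa,\mu}\bigl(-\omega(\Phi(\ell)-\Phi(\rho))^{\mu-\kappa}\bigr)\mathbb F(\rho,\mathfrak z_n(\rho))\,\mathrm d\rho$, where $\mathbb E_{p,q}(x)=\sum_{k\ge0}x^k/\Gamma(pk+q)$. "Monotone" means pointwise monotone in $n$. Extremal solutions in the sector: solutions $\mathfrak z^*,\tilde{\mathfrak z}^*\in[\mathfrak z_0,\tilde{\mathfrak z}_0]$ of $(P)$ such that every solution $\mathfrak z\in[\mathfrak z_0,\tilde{\mathfrak z}_0]$ of $(P)$ satisfies $\mathfrak z^*(\ell)\le\mathfrak z(\ell)\le\tilde{\mathfrak z}^*(\ell)$ on $\Delta$ (minimal and maximal solution). *)

theory Defs
  imports "HOL-Analysis.Analysis"
begin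

text \<open>
  Functions on the interval \<open>[a,b]\<close> are total functions on the reals of which only the values
  on \<open>{a..b}\<close> matter.  All derivatives are taken within \<open>{a..b}\<close>, i.e. one-sided at the
  endpoints (unlike the library's \<open>C1_differentiable_on\<close>, which is two-sided).
\<close>

definition C1_on :: "real set \<Rightarrow> (real \<Rightarrow> real) \<Rightarrow> bool" where
  "C1_on S f \<longleftrightarrow>
     f differentiable_on S \<and> continuous_on S (\<lambda>x. vector_derivative f (at x within S))"

text \<open>
  The Henstock-Kurzweil integral agrees with the Lebesgue integral whenever the latter exists,
  in particular for continuous \<open>z\<close> and \<open>\<alpha> > 0\<close>.  At \<open>\<rho> = l\<close> the convention
  \<open>0 powr c = 0\<close> affects a single point only.
\<close>

definition RL_integral ::
  "real \<Rightarrow> real \<Rightarrow> (real \<Rightarrow> real) \<Rightarrow> real \<Rightarrow> (real \<Rightarrow> real) \<Rightarrow> real \<Rightarrow> real" where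
  "RL_integral a b \<Phi> \<alpha> z l =
     (if \<alpha> = 0 then z l
      else 1 / Gamma \<alpha> *
        integral {a..l} (\<lambda>\<rho>. vector_derivative \<Phi> (at \<rho> within {a..b})
                               * (\<Phi> l - \<Phi> \<rho>) powr (\<alpha> - 1) * z \<rho>))"

text \<open>
  The Caputo derivative in its extended sense for continuous functions; it agrees with
  \<open>RL_integral a b \<Phi> (1 - \<alpha>) (z' / \<Phi>')\<close> when \<open>z\<close> is continuously differentiable.
\<close>

definition caputo ::
  "real \<Rightarrow> real \<Rightarrow> (real \<Rightarrow> real) \<Rightarrow> real \<Rightarrow> (real \<Rightarrow> real) \<Rightarrow> real \<Rightarrow> real" where
  "caputo a b \<Phi> \<alpha> z l =
     1 / vector_derivative \<Phi> (at l within {a..b})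
       * vector_derivative (RL_integral a b \<Phi> (1 - \<alpha>) (\<lambda>s. z s - z a)) (at l within {a..b})"

definition caputo_continuous ::
  "real \<Rightarrow> real \<Rightarrow> (real \<Rightarrow> real) \<Rightarrow> real \<Rightarrow> (real \<Rightarrow> real) \<Rightarrow> bool" where
  "caputo_continuous a b \<Phi> \<alpha> z \<longleftrightarrow>
     C1_on {a..b} (RL_integral a b \<Phi> (1 - \<alpha>) (\<lambda>s. z s - z a))"

definition admissible ::
  "real \<Rightarrow> real \<Rightarrow> (real \<Rightarrow> real) \<Rightarrow> real \<Rightarrow> real \<Rightarrow> (real \<Rightarrow> real) \<Rightarrow> bool" where
  "admissible a b \<Phi> \<mu> \<kappa> z \<longleftrightarrow>
     continuous_on {a..b} z \<and> caputo_continuous a b \<Phi> \<mu> z \<and> caputo_continuous a b \<Phi> \<kappa> z"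

definition solution ::
  "real \<Rightarrow> real \<Rightarrow> (real \<Rightarrow> real) \<Rightarrow> real \<Rightarrow> real \<Rightarrow> real \<Rightarrow> (real \<Rightarrow> real \<Rightarrow> real) \<Rightarrow> real
    \<Rightarrow> (real \<Rightarrow> real) \<Rightarrow> bool" where
  "solution a b \<Phi> \<mu> \<kappa> \<omega> F za z \<longleftrightarrow>
     admissible a b \<Phi> \<mu> \<kappa> z \<and>
     (\<forall>l\<in>{a..b}. caputo a b \<Phi> \<mu> z l + \<omega> * caputo a b \<Phi> \<kappa> z l = F l (z l)) \<and>
     z a = za"

definition lower_solution ::
  "real \<Rightarrow> real \<Rightarrow> (real \<Rightarrow> real) \<Rightarrow> real \<Rightarrow> real \<Rightarrow> real \<Rightarrow> (real \<Rightarrow> real \<Rightarrow> real) \<Rightarrow> real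
    \<Rightarrow> (real \<Rightarrow> real) \<Rightarrow> bool" where
  "lower_solution a b \<Phi> \<mu> \<kappa> \<omega> F za z \<longleftrightarrow>
     admissible a b \<Phi> \<mu> \<kappa> z \<and>
     (\<forall>l\<in>{a..b}. caputo a b \<Phi> \<mu> z l + \<omega> * caputo a b \<Phi> \<kappa> z l \<le> F l (z l)) \<and>
     z a \<le> za"

definition upper_solution ::
  "real \<Rightarrow> real \<Rightarrow> (real \<Rightarrow> real) \<Rightarrow> real \<Rightarrow> real \<Rightarrow> real \<Rightarrow> (real \<Rightarrow> real \<Rightarrow> real) \<Rightarrow> real
    \<Rightarrow> (real \<Rightarrow> real) \<Rightarrow> bool" where
  "upper_solution a b \<Phi> \<mu> \<kappa> \<omega> F za z \<longleftrightarrow>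
     admissible a b \<Phi> \<mu> \<kappa> z \<and>
     (\<forall>l\<in>{a..b}. caputo a b \<Phi> \<mu> z l + \<omega> * caputo a b \<Phi> \<kappa> z l \<ge> F l (z l)) \<and>
     z a \<ge> za"

definition sector ::
  "real \<Rightarrow> real \<Rightarrow> (real \<Rightarrow> real) \<Rightarrow> (real \<Rightarrow> real) \<Rightarrow> (real \<Rightarrow> real) set" where
  "sector a b z0 w0 =
     {z. continuous_on {a..b} z \<and> (\<forall>l\<in>{a..b}. z0 l \<le> z l \<and> z l \<le> w0 l)}"

text \<open>Uniqueness of functions always means uniqueness of their values on \<open>{a..b}\<close>.\<close>

definition unique_solution ::
  "real \<Rightarrow> real \<Rightarrow> (real \<Rightarrow> real) \<Rightarrow> real \<Rightarrow> real \<Rightarrow> real \<Rightarrow> (real \<Rightarrow> real \<Rightarrow> real) \<Rightarrow> real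
    \<Rightarrow> (real \<Rightarrow> real) \<Rightarrow> bool" where
  "unique_solution a b \<Phi> \<mu> \<kappa> \<omega> F za z \<longleftrightarrow>
     solution a b \<Phi> \<mu> \<kappa> \<omega> F za z \<and>
     (\<forall>u. solution a b \<Phi> \<mu> \<kappa> \<omega> F za u \<longrightarrow> (\<forall>l\<in>{a..b}. u l = z l))"

text \<open>
  Each iterate is the unique solution of the linear problem whose right-hand side, obtained by
  freezing the previous iterate, no longer depends on the unknown.
\<close>

definition iterative_sequence ::
  "real \<Rightarrow> real \<Rightarrow> (real \<Rightarrow> real) \<Rightarrow> real \<Rightarrow> real \<Rightarrow> real \<Rightarrow> (real \<Rightarrow> real \<Rightarrow> real) \<Rightarrow> real
    \<Rightarrow> (real \<Rightarrow> real) \<Rightarrow> (nat \<Rightarrow> real \<Rightarrow> real) \<Rightarrow> bool" where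
  "iterative_sequence a b \<Phi> \<mu> \<kappa> \<omega> F za z0 z \<longleftrightarrow>
     z 0 = z0 \<and>
     (\<forall>n. unique_solution a b \<Phi> \<mu> \<kappa> \<omega> (\<lambda>l _. F l (z n l)) za (z (Suc n)))"

definition extremal_solutions ::
  "real \<Rightarrow> real \<Rightarrow> (real \<Rightarrow> real) \<Rightarrow> real \<Rightarrow> real \<Rightarrow> real \<Rightarrow> (real \<Rightarrow> real \<Rightarrow> real) \<Rightarrow> real
    \<Rightarrow> (real \<Rightarrow> real) \<Rightarrow> (real \<Rightarrow> real) \<Rightarrow> (real \<Rightarrow> real) \<Rightarrow> (real \<Rightarrow> real) \<Rightarrow> bool" where
  "extremal_solutions a b \<Phi> \<mu> \<kappa> \<omega> F za z0 w0 zmin zmax \<longleftrightarrow>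
     zmin \<in> sector a b z0 w0 \<and> solution a b \<Phi> \<mu> \<kappa> \<omega> F za zmin \<and>
     zmax \<in> sector a b z0 w0 \<and> solution a b \<Phi> \<mu> \<kappa> \<omega> F za zmax \<and>
     (\<forall>z \<in> sector a b z0 w0. solution a b \<Phi> \<mu> \<kappa> \<omega> F za z \<longrightarrow>
        (\<forall>l\<in>{a..b}. zmin l \<le> z l \<and> z l \<le> zmax l))"

end

theory Submission
  imports Defs
begin

text \<open>
  Everything is reduced to integral equations.  Write \<open>J \<alpha>\<close> for the fractional integral of order \<open>\<alpha>\<close>
  with respect to \<open>\<Phi>\<close>.  The semigroup law \<open>J \<alpha> (J \<beta> z) = J (\<alpha> + \<beta>) z\<close> makes the extended Caputo
  derivative of order \<open>\<alpha>\<close> the inverse of \<open>J \<alpha>\<close>: a continuous \<open>z\<close> has a continuous derivative \<open>g\<close>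
  exactly when \<open>z = z a + J \<alpha> g\<close>.  Hence, for \<open>g\<close> the derivative of order \<open>\<mu>\<close>, the derivative of order
  \<open>\<kappa>\<close> is \<open>J (\<mu> - \<kappa>) g\<close>, and the linear problem with right-hand side \<open>f\<close> becomes the Volterra equation
  \<open>g + \<omega> * J (\<mu> - \<kappa>) g = f\<close> together with \<open>z = z a + J \<mu> g\<close>.

  The semigroup law is an identity between Gamma quotients on the powers of \<open>\<Phi> - \<Phi> a\<close>; it extends
  to continuous functions because the polynomials in \<open>\<Phi> - \<Phi> a\<close> are dense by Stone--Weierstrass and
  both sides are bounded operators (lemma \<open>J_semigroup\<close>).

  The Volterra equation is solved by a Neumann series.  A weight \<open>\<theta> = exp (r * (\<Phi> - \<Phi> a))\<close> with
  large \<open>r\<close> makes \<open>\<omega> * J (\<mu> - \<kappa>)\<close> a contraction by the factor one half (lemma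
  \<open>exponential_weight\<close>).  The same weight gives a Gronwall inequality, hence stability of the
  solution in the sup norm and, at the end, uniqueness under the Lipschitz condition.

  The heart of the matter is the comparison principle: \<open>f \<ge> 0\<close> implies \<open>z \<ge> z a\<close>.  In terms of
  Mittag-Leffler functions this says that \<open>E\<^bsub>\<mu>-\<kappa>,\<mu>\<^esub>(-x) \<ge> 0\<close> for \<open>x \<ge> 0\<close>.
  As \<open>J \<mu> = J \<kappa> \<circ> J (\<mu> - \<kappa>)\<close> and \<open>J \<kappa>\<close> is monotone, it suffices that \<open>J (\<mu> - \<kappa>) g \<ge> 0\<close>, where
  \<open>g + \<omega> * J (\<mu> - \<kappa>) g = f\<close> involves a single order only.  There the kernel is log-convex, and the second
  mean value theorem shows that nonnegativity of all partial integrals of \<open>g\<close> against the kernel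
  is inherited by later times; continuous induction in time concludes
  (lemma \<open>J_nonneg_of_strict_volterra\<close>).

  With the comparison principle the monotone iterative method applies.  The map that sends \<open>u\<close> to the
  solution of the linear problem with right-hand side \<open>F l (u l)\<close> is monotone on the sector and
  maps the lower solution upwards and the upper solution downwards, so its iterates are monotone and
  enclose every solution in the sector.  They are equicontinuous, since \<open>F\<close> is bounded on the
  sector and \<open>J \<mu>\<close> maps bounded sets to Hoelder-bounded sets; so they converge uniformly, and the
  limits are solutions by stability of the linear problem.
\<close>

section \<open>Auxiliary facts on real functions\<close>

lemma abs_integral_le:
  fixes f g :: "real \<Rightarrow> real"
  assumes "f integrable_on S" "g integrable_on S" "\<And>x. x \<in> S \<Longrightarrow> \<bar>f x\<bar> \<le> g x"
  shows "\<bar>integral S f\<bar> \<le> integral S g"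
  using Henstock_Kurzweil_Integration.integral_norm_bound_integral[of f S g] assms by simp

lemma Gamma_plus1_pos: "0 < \<alpha> \<Longrightarrow> Gamma (\<alpha> + 1) = \<alpha> * Gamma (\<alpha>::real)"
  by (metis Gamma_plus1 nonpos_Ints_nonpos not_less)

lemma powr_le_exp: assumes "0 < y" "0 < \<gamma>" "\<gamma> \<le> 1" shows "y powr \<gamma> \<le> exp (y::real)"
proof -
  have "\<gamma> * ln y \<le> y"
  proof (cases "ln y \<le> 0")
    case True
    then have "\<gamma> * ln y \<le> 0" using assms by (simp add: mult_nonneg_nonpos)
    then show ?thesis using assms by linarith
  next
    case False
    then have "\<gamma> * ln y \<le> 1 * ln y" using assms by (intro mult_right_mono) auto
    then show ?thesis using ln_less_self[OF \<open>0 < y\<close>] by linarith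
  qed
  then show ?thesis using assms by (simp add: powr_def)
qed

lemma continuous_on_pos_nhd:
  fixes f :: "real \<Rightarrow> real"
  assumes "continuous_on S f" "x \<in> S" "0 < f x"
  obtains \<delta> where "0 < \<delta>" "\<And>y. y \<in> S \<Longrightarrow> \<bar>y - x\<bar> < \<delta> \<Longrightarrow> 0 < f y"
proof -
  obtain \<delta> where \<delta>: "0 < \<delta>" "\<forall>y\<in>S. dist y x < \<delta> \<longrightarrow> dist (f y) (f x) < f x"
    using assms unfolding continuous_on_iff by blast
  show thesis
  proof (rule that[OF \<delta>(1)])
    fix y assume "y \<in> S" "\<bar>y - x\<bar> < \<delta>"
    then have "dist (f y) (f x) < f x" using \<delta>(2) by (simp add: dist_real_def)
    then show "0 < f y" by (simp add: dist_real_def)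
  qed
qed

text \<open>
  Closeness on a finite net spreads to the whole compact set by equicontinuity.
\<close>
lemma equicontinuous_pointwise_imp_uniform_limit:
  fixes u :: "nat \<Rightarrow> 'a::metric_space \<Rightarrow> 'b::metric_space"
  assumes S: "compact S"
    and equi: "\<And>e. 0 < e \<Longrightarrow> \<exists>d>0. \<forall>n. \<forall>x\<in>S. \<forall>y\<in>S. dist x y < d \<longrightarrow> dist (u n x) (u n y) < e"
    and lim: "\<And>x. x \<in> S \<Longrightarrow> (\<lambda>n. u n x) \<longlonglongrightarrow> v x"
  shows "uniform_limit S u v sequentially"
proof (rule uniform_limitI)
  fix e :: real assume e: "0 < e"
  then obtain d where d: "0 < d"
    and u: "\<And>n x y. x \<in> S \<Longrightarrow> y \<in> S \<Longrightarrow> dist x y < d \<Longrightarrow> dist (u n x) (u n y) < e / 4"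
    using equi[of "e / 4"] by auto
  have v: "dist (v x) (v y) \<le> e / 4" if "x \<in> S" "y \<in> S" "dist x y < d" for x y
    using u[OF that] lim that
    by (intro tendsto_upperbound[OF tendsto_dist[OF lim lim]]) (auto intro: less_imp_le always_eventually)
  have "S \<subseteq> (\<Union>x\<in>S. ball x d)" using d by auto
  then obtain N where N: "N \<subseteq> S" "finite N" "S \<subseteq> (\<Union>x\<in>N. ball x d)"
    by (rule compactE_image[OF S open_ball])
  have "\<forall>\<^sub>F n in sequentially. \<forall>x\<in>N. dist (u n x) (v x) < e / 4"
    using N(1,2) lim e by (intro eventually_ball_finite ballI tendstoD) auto
  then show "\<forall>\<^sub>F n in sequentially. \<forall>x\<in>S. dist (u n x) (v x) < e"
  proof eventually_elim
    case (elim n)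
    show ?case
    proof
      fix x assume x: "x \<in> S"
      then obtain y where y: "y \<in> N" "dist y x < d" using N(3) by auto
      then have "y \<in> S" using N(1) by auto
      then have "dist (u n x) (u n y) < e / 4" "dist (v y) (v x) \<le> e / 4"
        using u[of x y n] v[of y x] x y by (auto simp: dist_commute)
      moreover have "dist (u n x) (v x) \<le> dist (u n x) (u n y) + (dist (u n y) (v y) + dist (v y) (v x))"
        by (meson dist_triangle order_trans add_left_mono)
      ultimately show "dist (u n x) (v x) < e" using bspec[OF elim y(1)] e by linarith
    qed
  qed
qed

section \<open>The fractional integral: kernel, continuity, semigroup law\<close>

text \<open>
  The function \<open>\<Phi>\<close> acts as a change of time: every integral below is a classical fractional
  integral in the variable \<open>\<Phi> s\<close>.
\<close>
locale phi_clock =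
  fixes a b :: real and \<Phi> :: "real \<Rightarrow> real"
  assumes a_less_b: "a < b"
    and C1_Phi: "C1_on {a..b} \<Phi>"
    and mono_Phi: "mono_on {a..b} \<Phi>"
    and deriv_Phi_nz: "\<forall>l\<in>{a..b}. vector_derivative \<Phi> (at l within {a..b}) \<noteq> 0"
begin

abbreviation \<phi> :: "real \<Rightarrow> real" where
  "\<phi> s \<equiv> vector_derivative \<Phi> (at s within {a..b})"

abbreviation J :: "real \<Rightarrow> (real \<Rightarrow> real) \<Rightarrow> real \<Rightarrow> real" where
  "J \<equiv> RL_integral a b \<Phi>"

definition ker :: "real \<Rightarrow> real \<Rightarrow> real \<Rightarrow> real" where
  "ker \<alpha> l s = \<phi> s * (\<Phi> l - \<Phi> s) powr (\<alpha> - 1)"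

lemma J_eq: "J \<alpha> z l = (if \<alpha> = 0 then z l else integral {a..l} (\<lambda>s. ker \<alpha> l s * z s) / Gamma \<alpha>)"
  by (simp add: RL_integral_def ker_def)

lemma Phi_has_derivative:
  assumes "l \<in> {a..b}" shows "(\<Phi> has_field_derivative \<phi> l) (at l within {a..b})"
  using C1_Phi assms
  by (simp add: C1_on_def differentiable_on_def vector_derivative_works
      has_real_derivative_iff_has_vector_derivative)

lemma Phi_has_derivative_interior:
  assumes "l \<in> {a<..<b}" shows "(\<Phi> has_field_derivative \<phi> l) (at l)"
  using Phi_has_derivative[of l] assms by (auto simp: at_within_Icc_at)

lemma continuous_on_Phi: "continuous_on {a..b} \<Phi>"
  using C1_Phi by (simp add: C1_on_def differentiable_imp_continuous_on)

lemma continuous_on_phi: "continuous_on {a..b} \<phi>"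
  using C1_Phi by (simp add: C1_on_def)

lemma phi_pos: assumes l: "l \<in> {a..b}" shows "0 < \<phi> l"
proof -
  have "((\<lambda>y. (\<Phi> y - \<Phi> l) / (y - l)) \<longlongrightarrow> \<phi> l) (at l within {a..b})"
    using Phi_has_derivative[OF l] by (simp add: has_field_derivative_iff)
  moreover have "\<forall>\<^sub>F y in at l within {a..b}. 0 \<le> (\<Phi> y - \<Phi> l) / (y - l)"
    unfolding eventually_at_filter
  proof (rule always_eventually, intro allI impI)
    fix y assume "y \<noteq> l" "y \<in> {a..b}"
    then show "0 \<le> (\<Phi> y - \<Phi> l) / (y - l)"
      using mono_onD[OF mono_Phi, of y l] mono_onD[OF mono_Phi, of l y] l
      by (cases "y < l") (auto simp: divide_nonpos_neg)
  qed
  moreover have "at l within {a..b} \<noteq> bot"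
    using l a_less_b by (simp add: trivial_limit_within)
  ultimately have "0 \<le> \<phi> l" by (intro tendsto_lowerbound)
  then show ?thesis using deriv_Phi_nz l by (simp add: less_le)
qed

lemma Phi_less: assumes "a \<le> x" "x < y" "y \<le> b" shows "\<Phi> x < \<Phi> y"
proof (rule DERIV_pos_imp_increasing_open[OF \<open>x < y\<close>])
  fix s assume "x < s" "s < y"
  then show "\<exists>d. (\<Phi> has_real_derivative d) (at s) \<and> 0 < d"
    using Phi_has_derivative_interior[of s] phi_pos[of s] assms by auto
qed (use assms in \<open>auto intro: continuous_on_subset[OF continuous_on_Phi]\<close>)

lemma Phi_le: "a \<le> x \<Longrightarrow> x \<le> y \<Longrightarrow> y \<le> b \<Longrightarrow> \<Phi> x \<le> \<Phi> y"
  using Phi_less[of x y] by (cases "x = y") auto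

lemma ker_nonneg: "s \<in> {a..b} \<Longrightarrow> 0 \<le> ker \<alpha> l s"
  using phi_pos[of s] by (simp add: ker_def)

lemma has_integral_ker:
  assumes "0 < \<alpha>" "a \<le> c" "c \<le> l" "l \<le> b"
  shows "(ker \<alpha> l has_integral (\<Phi> l - \<Phi> c) powr \<alpha> / \<alpha>) {c..l}"
proof -
  have "(ker \<alpha> l has_integral - ((\<Phi> l - \<Phi> l) powr \<alpha>) / \<alpha> - (- ((\<Phi> l - \<Phi> c) powr \<alpha>) / \<alpha>)) {c..l}"
  proof (rule fundamental_theorem_of_calculus_interior)
    have "continuous_on {c..l} \<Phi>"
      using assms by (auto intro: continuous_on_subset[OF continuous_on_Phi])
    then show "continuous_on {c..l} (\<lambda>s. - ((\<Phi> l - \<Phi> s) powr \<alpha>) / \<alpha>)"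
      using assms by (intro continuous_intros continuous_on_powr') (auto intro: Phi_le)
    fix s assume s: "s \<in> {c<..<l}"
    then have "0 < \<Phi> l - \<Phi> s" using assms Phi_less[of s l] by auto
    moreover have "(\<Phi> has_field_derivative \<phi> s) (at s)"
      using s assms by (intro Phi_has_derivative_interior) auto
    ultimately show "((\<lambda>s. - ((\<Phi> l - \<Phi> s) powr \<alpha>) / \<alpha>) has_vector_derivative ker \<alpha> l s) (at s)"
      using \<open>0 < \<alpha>\<close> unfolding has_real_derivative_iff_has_vector_derivative[symmetric] ker_def
      by (auto intro!: derivative_eq_intros simp: powr_diff field_simps)
  qed (use assms in auto)
  then show ?thesis by simp
qed

lemma absolutely_integrable_ker_times:
  assumes "0 < \<alpha>" "a \<le> c" "c \<le> x" "x \<le> l" "l \<le> b" and z: "continuous_on {a..b} z"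
  shows "(\<lambda>s. ker \<alpha> l s * z s) absolutely_integrable_on {c..x}"
proof -
  have k: "ker \<alpha> l absolutely_integrable_on {c..l}"
    using has_integral_ker[of \<alpha> c l] assms
    by (intro nonnegative_absolutely_integrable_1) (auto intro: ker_nonneg)
  have z': "continuous_on {c..l} z" using assms by (auto intro: continuous_on_subset)
  have "(\<lambda>s. z s * ker \<alpha> l s) absolutely_integrable_on {c..l}"
  proof (rule absolutely_integrable_bounded_measurable_product_real[OF _ _ _ k])
    show "z \<in> borel_measurable (lebesgue_on {c..l})"
      using z' by (simp add: continuous_imp_measurable_on_sets_lebesgue)
    show "bounded (z ` {c..l})" using z' by (simp add: compact_continuous_image compact_imp_bounded)
  qed simp
  then have "(\<lambda>s. ker \<alpha> l s * z s) absolutely_integrable_on {c..l}"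
    by (simp add: mult.commute)
  then show ?thesis
    by (rule absolutely_integrable_on_subinterval) (use assms in auto)
qed

lemma integrable_ker_times:
  assumes "0 < \<alpha>" "a \<le> c" "c \<le> x" "x \<le> l" "l \<le> b" and z: "continuous_on {a..b} z"
  shows "(\<lambda>s. ker \<alpha> l s * z s) integrable_on {c..x}"
  using absolutely_integrable_ker_times[OF assms] by (simp add: absolutely_integrable_on_def)

text \<open>
  The substitution \<open>x = (\<Phi> s - \<Phi> a) / (\<Phi> l - \<Phi> a)\<close> turns the integral into Euler's Beta integral.
\<close>
lemma has_integral_ker_power:
  assumes "0 < \<alpha>" "0 < p" "l \<in> {a..b}"
  shows "((\<lambda>s. ker \<alpha> l s * (\<Phi> s - \<Phi> a) powr p) has_integral
            Beta (p + 1) \<alpha> * (\<Phi> l - \<Phi> a) powr (p + \<alpha>)) {a..l}"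
proof (cases "l = a")
  case False
  define L where "L = \<Phi> l - \<Phi> a"
  have L: "0 < L" using False assms Phi_less[of a l] by (auto simp: L_def)
  define g where "g = (\<lambda>s. (\<Phi> s - \<Phi> a) / L)"
  define f where "f = (\<lambda>x::real. x powr (p + 1 - 1) * (1 - x) powr (\<alpha> - 1))"
  have sub: "{a..l} \<subseteq> {a..b}" using assms by auto
  have g_der: "(g has_field_derivative \<phi> s / L) (at s within {a..l})" if "s \<in> {a..l}" for s
    using DERIV_subset[OF Phi_has_derivative[of s] sub] that sub L unfolding g_def
    by (auto intro!: derivative_eq_intros)
  have inj: "inj_on g {a..l}"
    using assms L by (auto simp: g_def inj_on_def) (metis Phi_less less_irrefl linorder_neqE order_trans)
  have cont: "continuous_on {a..l} g"
    using g_der by (rule DERIV_continuous_on)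
  have ga: "g a = 0" and gl: "g l = 1" using L by (auto simp: g_def L_def)
  have img: "g ` {a..l} = {0..1}"
  proof
    show "g ` {a..l} \<subseteq> {0..1}"
      using L assms Phi_le[of a] Phi_le[of _ l] by (auto simp: g_def L_def divide_le_eq)
    show "{0..1} \<subseteq> g ` {a..l}"
    proof
      fix y :: real assume "y \<in> {0..1}"
      then show "y \<in> g ` {a..l}" using IVT'[of g a y l] ga gl cont assms by force
    qed
  qed
  have B: "(f has_integral Beta (p + 1) \<alpha>) {0..1}"
    unfolding f_def using assms by (intro has_integral_Beta_real) auto
  then have "f absolutely_integrable_on {0..1}"
    by (intro nonnegative_absolutely_integrable_1) (auto simp: f_def)
  then have *: "(\<lambda>s. \<bar>\<phi> s / L\<bar> * f (g s)) absolutely_integrable_on {a..l}"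
    "integral {a..l} (\<lambda>s. \<bar>\<phi> s / L\<bar> * f (g s)) = Beta (p + 1) \<alpha>"
    using has_absolute_integral_change_of_variables_1'[of "{a..l}" g "\<lambda>s. \<phi> s / L" f "Beta (p + 1) \<alpha>"]
      g_der inj B img by (auto simp: has_integral_iff)
  have "((\<lambda>s. \<bar>\<phi> s / L\<bar> * f (g s)) has_integral Beta (p + 1) \<alpha>) {a..l}"
    using * by (simp add: has_integral_iff absolutely_integrable_on_def)
  then have "((\<lambda>s. \<bar>\<phi> s / L\<bar> * f (g s) * L powr (p + \<alpha>)) has_integral
      Beta (p + 1) \<alpha> * L powr (p + \<alpha>)) {a..l}"
    by (rule has_integral_mult_left)
  then show ?thesis unfolding L_def[symmetric]
  proof (rule has_integral_eq[rotated])
    fix s assume s: "s \<in> {a..l}"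
    have 1: "1 - g s = (\<Phi> l - \<Phi> s) / L" using L by (simp add: g_def field_simps L_def)
    have pos: "0 \<le> \<Phi> l - \<Phi> s" "0 \<le> \<Phi> s - \<Phi> a" "0 < \<phi> s"
      using s assms phi_pos by (auto intro: Phi_le)
    have "L powr (p + \<alpha>) = L * L powr p * L powr (\<alpha> - 1)"
      using L by (simp add: powr_add powr_diff)
    then show "\<bar>\<phi> s / L\<bar> * f (g s) * L powr (p + \<alpha>) = ker \<alpha> l s * (\<Phi> s - \<Phi> a) powr p"
      unfolding f_def 1 ker_def using pos L by (simp add: g_def powr_divide)
  qed
qed (use assms in auto)

lemma J_0 [simp]: "J 0 z l = z l"
  by (simp add: J_eq)

lemma J_cong:
  assumes "a \<le> l" "\<And>s. s \<in> {a..l} \<Longrightarrow> z s = y s" shows "J \<alpha> z l = J \<alpha> y l"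
  using assms by (auto simp: J_eq intro!: integral_cong)

lemma J_start: "0 < \<alpha> \<Longrightarrow> J \<alpha> z a = 0"
  by (simp add: J_eq)

lemma J_add:
  assumes "0 \<le> \<alpha>" "l \<in> {a..b}" "continuous_on {a..b} z" "continuous_on {a..b} y"
  shows "J \<alpha> (\<lambda>s. z s + y s) l = J \<alpha> z l + J \<alpha> y l"
  using assms integrable_ker_times[of \<alpha> a l l]
  by (auto simp: J_eq distrib_left integral_add add_divide_distrib)

lemma J_cmult: "J \<alpha> (\<lambda>s. c * z s) l = c * J \<alpha> z l"
  by (simp add: J_eq mult.left_commute[of _ c])

lemma J_diff:
  assumes "0 \<le> \<alpha>" "l \<in> {a..b}" "continuous_on {a..b} z" "continuous_on {a..b} y"
  shows "J \<alpha> (\<lambda>s. z s - y s) l = J \<alpha> z l - J \<alpha> y l"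
  using J_add[OF assms(1-3), of "\<lambda>s. - 1 * y s"] J_cmult[of \<alpha> "-1" y l] assms
  by (simp add: continuous_intros)

lemma J_zero [simp]: "J \<alpha> (\<lambda>s. 0) l = 0"
  by (simp add: J_eq)

lemma J_sum:
  assumes "0 \<le> \<alpha>" "l \<in> {a..b}" "finite I" "\<And>i. i \<in> I \<Longrightarrow> continuous_on {a..b} (z i)"
  shows "J \<alpha> (\<lambda>s. \<Sum>i\<in>I. z i s) l = (\<Sum>i\<in>I. J \<alpha> (z i) l)"
  using assms(3,4)
proof (induction I rule: finite_induct)
  case (insert i I)
  then show ?case
    using J_add[of \<alpha> l "z i" "\<lambda>s. \<Sum>i\<in>I. z i s"] assms by (simp add: continuous_on_sum)
qed simp

lemma J_mono:
  assumes "0 \<le> \<alpha>" "l \<in> {a..b}" "continuous_on {a..b} z" "continuous_on {a..b} y"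
    and "\<And>s. s \<in> {a..l} \<Longrightarrow> z s \<le> y s"
  shows "J \<alpha> z l \<le> J \<alpha> y l"
proof (cases "\<alpha> = 0")
  case False
  then have "integral {a..l} (\<lambda>s. ker \<alpha> l s * z s) \<le> integral {a..l} (\<lambda>s. ker \<alpha> l s * y s)"
    using assms by (intro integral_le integrable_ker_times mult_left_mono ker_nonneg) auto
  with False assms show ?thesis by (simp add: J_eq divide_right_mono less_imp_le)
qed (use assms in simp)

text \<open>
  The powers of \<open>\<Phi> - \<Phi> a\<close>.  The case distinction makes the power of exponent \<open>0\<close> the constant \<open>1\<close>
  also at \<open>a\<close>, where \<open>0 powr 0 = 0\<close>, and hence continuous.
\<close>
definition Phi_pow :: "real \<Rightarrow> real \<Rightarrow> real" where
  "Phi_pow p s = (if p = 0 then 1 else (\<Phi> s - \<Phi> a) powr p)"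

lemma continuous_on_Phi_pow: assumes "0 \<le> p" shows "continuous_on {a..b} (Phi_pow p)"
proof (cases "p = 0")
  case False
  then have "continuous_on {a..b} (\<lambda>s. (\<Phi> s - \<Phi> a) powr p)"
    using assms by (intro continuous_intros continuous_on_powr' continuous_on_Phi) (auto intro: Phi_le)
  with False show ?thesis by (simp add: Phi_pow_def[abs_def])
qed (simp add: Phi_pow_def[abs_def])

lemma Phi_pow_nat: assumes "s \<in> {a..b}" shows "Phi_pow (real n) s = (\<Phi> s - \<Phi> a) ^ n"
  using Phi_le[of a s] assms by (cases "n = 0") (auto simp: Phi_pow_def powr_realpow')

lemma Phi_pow_mono: "0 \<le> p \<Longrightarrow> a \<le> s \<Longrightarrow> s \<le> t \<Longrightarrow> t \<le> b \<Longrightarrow> Phi_pow p s \<le> Phi_pow p t"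
  using Phi_le[of a s] Phi_le[of s t] by (auto simp: Phi_pow_def intro!: powr_mono2)

lemma Phi_pow_nonneg: "0 \<le> Phi_pow p s"
  by (simp add: Phi_pow_def)

lemma J_pow:
  assumes "0 \<le> \<alpha>" "0 \<le> p" "l \<in> {a..b}"
  shows "J \<alpha> (Phi_pow p) l = Gamma (p + 1) / Gamma (p + \<alpha> + 1) * Phi_pow (p + \<alpha>) l"
proof (cases "\<alpha> = 0")
  case True
  then show ?thesis using less_imp_neq[OF Gamma_real_pos[of "p + 1"]] assms by auto
next
  case False
  then have \<alpha>: "0 < \<alpha>" and "Gamma \<alpha> \<noteq> 0"
    using assms less_imp_neq[OF Gamma_real_pos[of \<alpha>]] by auto
  show ?thesis
  proof (cases "p = 0")
    case True
    then show ?thesis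
      using has_integral_ker[of \<alpha> a l] \<alpha> assms Gamma_plus1_pos[of \<alpha>]
      by (auto simp: J_eq Phi_pow_def[abs_def] add.commute[of 1] mult.commute dest!: integral_unique)
  next
    case False
    then show ?thesis
      using has_integral_ker_power[of \<alpha> p l] \<alpha> assms \<open>Gamma \<alpha> \<noteq> 0\<close>
      by (auto simp: J_eq Phi_pow_def[abs_def] add_ac Beta_def dest!: integral_unique)
  qed
qed

text \<open>
  The operator norm of \<open>J \<alpha>\<close> on the continuous functions with the sup norm: \<open>J \<alpha>\<close> of the constant
  \<open>1\<close>, at the right endpoint.
\<close>
definition J_norm :: "real \<Rightarrow> real" where
  "J_norm \<alpha> = Phi_pow \<alpha> b / Gamma (\<alpha> + 1)"

lemma J_norm_nonneg: "0 \<le> \<alpha> \<Longrightarrow> 0 \<le> J_norm \<alpha>"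
  using Gamma_real_pos[of "\<alpha> + 1"] by (auto simp: J_norm_def Phi_pow_nonneg)

lemma J_const_le:
  assumes "0 \<le> \<alpha>" "l \<in> {a..b}" "0 \<le> e" shows "J \<alpha> (\<lambda>_. e) l \<le> e * J_norm \<alpha>"
proof -
  have "J \<alpha> (\<lambda>_. e) l = e * J \<alpha> (Phi_pow 0) l"
    using J_cmult[of \<alpha> e "\<lambda>_. 1" l] by (simp add: Phi_pow_def[abs_def])
  also have "\<dots> = e * (Phi_pow \<alpha> l / Gamma (\<alpha> + 1))"
    using assms by (simp add: J_pow)
  also have "\<dots> \<le> e * J_norm \<alpha>"
    unfolding J_norm_def using assms Gamma_real_pos[of "\<alpha> + 1"]
    by (intro mult_left_mono divide_right_mono Phi_pow_mono) auto
  finally show ?thesis .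
qed

lemma J_abs_le:
  assumes "0 \<le> \<alpha>" "l \<in> {a..b}" "continuous_on {a..b} z" "continuous_on {a..b} y"
    and "\<And>s. s \<in> {a..l} \<Longrightarrow> \<bar>z s\<bar> \<le> y s"
  shows "\<bar>J \<alpha> z l\<bar> \<le> J \<alpha> y l"
proof -
  have "J \<alpha> z l \<le> J \<alpha> y l"
    by (rule J_mono) (use assms in \<open>force+\<close>)
  moreover have "J \<alpha> (\<lambda>s. - 1 * y s) l \<le> J \<alpha> z l"
    by (rule J_mono) (use assms in \<open>force intro: continuous_intros\<close>)+
  ultimately show ?thesis unfolding J_cmult by linarith
qed

lemma J_bound:
  assumes "0 \<le> \<alpha>" "l \<in> {a..b}" "continuous_on {a..b} z" 
    and "\<And>s. s \<in> {a..l} \<Longrightarrow> \<bar>z s\<bar> \<le> e" "0 \<le> e"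
  shows "\<bar>J \<alpha> z l\<bar> \<le> e * J_norm \<alpha>"
  using J_abs_le[of \<alpha> l z "\<lambda>_. e"] J_const_le[of \<alpha> l e] assms by force

text \<open>
  Hoelder continuity.  The kernel decreases as the outer time grows, so the change of the kernel on
  \<open>{a..t}\<close> has a sign and its integral can be computed; both that integral and the integral over
  \<open>{t..u}\<close> are at most \<open>(\<Phi> u - \<Phi> t) powr \<alpha> / \<alpha>\<close>.
\<close>
lemma J_modulus:
  assumes "0 < \<alpha>" "\<alpha> \<le> 1" "a \<le> t" "t \<le> u" "u \<le> b" and z: "continuous_on {a..b} z"
    and K: "\<And>s. s \<in> {a..b} \<Longrightarrow> \<bar>z s\<bar> \<le> K"
  shows "\<bar>J \<alpha> z u - J \<alpha> z t\<bar> \<le> 2 * K / Gamma (\<alpha> + 1) * (\<Phi> u - \<Phi> t) powr \<alpha>"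
proof -
  have G: "0 < Gamma \<alpha>" using assms by (simp add: Gamma_real_pos)
  have K0: "0 \<le> K" using K[of a] a_less_b by force
  have \<alpha>0: "\<alpha> \<noteq> 0" using assms by simp
  define k where "k = (\<lambda>s. ker \<alpha> t s - ker \<alpha> u s)"
  let ?P = "(\<Phi> u - \<Phi> t) powr \<alpha>"
  have "(k has_integral (\<Phi> t - \<Phi> a) powr \<alpha> / \<alpha> - ((\<Phi> u - \<Phi> a) powr \<alpha> / \<alpha> - ?P / \<alpha>)) {a..t}"
  proof -
    have i: "(ker \<alpha> u has_integral integral {a..t} (ker \<alpha> u)) {a..t}"
      using integrable_ker_times[of \<alpha> a t u "\<lambda>_. 1"] assms by (simp add: integrable_integral)
    from has_integral_combine[OF _ _ i has_integral_ker[of \<alpha> t u]]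
    have "(ker \<alpha> u has_integral integral {a..t} (ker \<alpha> u) + ?P / \<alpha>) {a..u}"
      using assms by simp
    with has_integral_ker[of \<alpha> a u]
    have "integral {a..t} (ker \<alpha> u) = (\<Phi> u - \<Phi> a) powr \<alpha> / \<alpha> - ?P / \<alpha>"
      using assms by (auto dest: has_integral_unique)
    with i have "(ker \<alpha> u has_integral (\<Phi> u - \<Phi> a) powr \<alpha> / \<alpha> - ?P / \<alpha>) {a..t}" by simp
    with has_integral_ker[of \<alpha> a t] show ?thesis
      unfolding k_def using assms by (auto intro!: has_integral_diff)
  qed
  \<comment> \<open>At \<open>s = t\<close> the kernel difference has the wrong sign, because \<open>ker \<alpha> t t = 0\<close> by
      \<open>0 powr (\<alpha> - 1) = 0\<close>; the open interval avoids this point.\<close>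
  then have k_int: "(k has_integral (\<Phi> t - \<Phi> a) powr \<alpha> / \<alpha> - ((\<Phi> u - \<Phi> a) powr \<alpha> / \<alpha> - ?P / \<alpha>)) {a<..<t}"
    by (simp add: has_integral_Icc_iff_Ioo)
  have P: "(\<Phi> t - \<Phi> a) powr \<alpha> \<le> (\<Phi> u - \<Phi> a) powr \<alpha>"
    using assms Phi_le by (intro powr_mono2) auto
  have kz: "(\<lambda>s. k s * z s) integrable_on {a..t}"
    unfolding k_def left_diff_distrib using assms
    by (intro integrable_diff integrable_ker_times) auto
  have 1: "\<bar>integral {a..t} (\<lambda>s. k s * z s)\<bar> \<le> K * (?P / \<alpha>)"
  proof -
    have "\<bar>integral {a<..<t} (\<lambda>s. k s * z s)\<bar> \<le> integral {a<..<t} (\<lambda>s. K * k s)"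
    proof (rule abs_integral_le)
      show "(\<lambda>s. k s * z s) integrable_on {a<..<t}" 
        using kz by (simp add: integrable_on_open_interval_real)
      show "(\<lambda>s. K * k s) integrable_on {a<..<t}" 
        using k_int by (auto intro: integrable_on_mult_right simp: integrable_on_def)
      fix s assume s: "s \<in> {a<..<t}"
      have "(\<Phi> u - \<Phi> s) powr (\<alpha> - 1) \<le> (\<Phi> t - \<Phi> s) powr (\<alpha> - 1)"
        using s assms Phi_less[of s t] Phi_le[of t u] by (intro powr_mono2') auto
      then have "0 \<le> k s" using s assms phi_pos[of s]
        by (auto simp: k_def ker_def)
      then show "\<bar>k s * z s\<bar> \<le> K * k s"
        using mult_left_mono[OF K[of s], of "k s"] s assms by (simp add: abs_mult mult.commute)
    qed
    also have "\<dots> = K * ((\<Phi> t - \<Phi> a) powr \<alpha> / \<alpha> - ((\<Phi> u - \<Phi> a) powr \<alpha> / \<alpha> - ?P / \<alpha>))"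
      using k_int by (simp add: integral_unique)
    also have "\<dots> \<le> K * (?P / \<alpha>)"
      using P K0 \<open>0 < \<alpha>\<close> by (intro mult_left_mono) (auto simp: divide_right_mono)
    finally show ?thesis by (simp add: integral_open_interval_real)
  qed
  have kz2: "(\<lambda>s. ker \<alpha> u s * z s) integrable_on {t..u}"
    using assms by (intro integrable_ker_times) auto
  have 2: "\<bar>integral {t..u} (\<lambda>s. ker \<alpha> u s * z s)\<bar> \<le> K * (?P / \<alpha>)"
  proof -
    have "\<bar>integral {t..u} (\<lambda>s. ker \<alpha> u s * z s)\<bar> \<le> integral {t..u} (\<lambda>s. K * ker \<alpha> u s)"
    proof (rule abs_integral_le)
      show "(\<lambda>s. K * ker \<alpha> u s) integrable_on {t..u}"
        using has_integral_ker[of \<alpha> t u] assms by (intro integrable_on_mult_right) (auto simp: integrable_on_def)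
      fix s assume s: "s \<in> {t..u}"
      with ker_nonneg[of s \<alpha> u] assms show "\<bar>ker \<alpha> u s * z s\<bar> \<le> K * ker \<alpha> u s"
        using mult_right_mono[OF K[of s], of "ker \<alpha> u s"] by (simp add: abs_mult mult.commute)
    qed (rule kz2)
    also have "\<dots> = K * (?P / \<alpha>)"
      using has_integral_ker[of \<alpha> t u] assms by (simp add: integral_unique)
    finally show ?thesis .
  qed
  have "integral {a..u} (\<lambda>s. ker \<alpha> u s * z s)
      = integral {a..t} (\<lambda>s. ker \<alpha> u s * z s) + integral {t..u} (\<lambda>s. ker \<alpha> u s * z s)"
    using assms by (intro Henstock_Kurzweil_Integration.integral_combine[symmetric] integrable_ker_times) auto
  moreover have "integral {a..t} (\<lambda>s. k s * z s)
      = integral {a..t} (\<lambda>s. ker \<alpha> t s * z s) - integral {a..t} (\<lambda>s. ker \<alpha> u s * z s)"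
    unfolding k_def left_diff_distrib using assms
    by (intro integral_diff integrable_ker_times) auto
  ultimately have "\<bar>integral {a..u} (\<lambda>s. ker \<alpha> u s * z s) - integral {a..t} (\<lambda>s. ker \<alpha> t s * z s)\<bar>
      \<le> 2 * K * ?P / \<alpha>"
    using 1 2 by simp
  then have "\<bar>integral {a..u} (\<lambda>s. ker \<alpha> u s * z s) - integral {a..t} (\<lambda>s. ker \<alpha> t s * z s)\<bar> / Gamma \<alpha>
      \<le> 2 * K * ?P / \<alpha> / Gamma \<alpha>"
    using G by (intro divide_right_mono) auto
  then show ?thesis
    using G \<alpha>0 \<open>0 < \<alpha>\<close> Gamma_plus1_pos[of \<alpha>] by (simp add: J_eq abs_divide diff_divide_distrib[symmetric] mult.commute)
qed

lemma continuous_on_J: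
  assumes "0 \<le> \<alpha>" "\<alpha> \<le> 1" and z: "continuous_on {a..b} z"
  shows "continuous_on {a..b} (J \<alpha> z)"
proof (cases "\<alpha> = 0")
  case False
  then have \<alpha>: "0 < \<alpha>" using assms by simp
  have "bounded (z ` {a..b})" using z by (simp add: compact_continuous_image compact_imp_bounded)
  then obtain K where "\<forall>x\<in>z ` {a..b}. norm x \<le> K" unfolding bounded_iff by blast
  then have K: "\<bar>z s\<bar> \<le> K" if "s \<in> {a..b}" for s using that by simp
  define M where "M = 2 * K / Gamma (\<alpha> + 1)"
  show ?thesis unfolding continuous_on
  proof
    fix t assume t: "t \<in> {a..b}"
    have ev: "\<forall>\<^sub>F u in at t within {a..b}. norm (J \<alpha> z u - J \<alpha> z t) \<le> M * \<bar>\<Phi> u - \<Phi> t\<bar> powr \<alpha>"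
      unfolding eventually_at_filter
    proof (rule always_eventually, intro allI impI)
      fix u assume u: "u \<in> {a..b}"
      show "norm (J \<alpha> z u - J \<alpha> z t) \<le> M * \<bar>\<Phi> u - \<Phi> t\<bar> powr \<alpha>"
        using J_modulus[of \<alpha> t u z K] J_modulus[of \<alpha> u t z K] Phi_le[of t u] Phi_le[of u t] t u K z \<alpha> assms
        by (cases "t \<le> u") (auto simp: M_def abs_minus_commute)
    qed
    have "((\<lambda>u. M * \<bar>\<Phi> u - \<Phi> t\<bar> powr \<alpha>) \<longlongrightarrow> M * \<bar>\<Phi> t - \<Phi> t\<bar> powr \<alpha>) (at t within {a..b})"
      using continuous_on_Phi t \<alpha> unfolding continuous_on
      by (intro tendsto_intros tendsto_powr') auto
    then have "((\<lambda>u. M * \<bar>\<Phi> u - \<Phi> t\<bar> powr \<alpha>) \<longlongrightarrow> 0) (at t within {a..b})" by simp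
    from Lim_null_comparison[OF ev this]
    show "(J \<alpha> z \<longlongrightarrow> J \<alpha> z t) (at t within {a..b})" by (simp add: Lim_null[symmetric])
  qed
next
  case True
  then have "J \<alpha> z = z" by (simp add: fun_eq_iff)
  with z show ?thesis by simp
qed

lemma Phi_polynomials_dense:
  assumes "continuous_on {a..b} z" "0 < e"
  obtains p :: "nat \<Rightarrow> real" and n where
    "\<And>s. s \<in> {a..b} \<Longrightarrow> \<bar>z s - (\<Sum>i\<le>n. p i * Phi_pow (real i) s)\<bar> < e"
proof -
  define P where "P = (\<lambda>f. \<exists>q. real_polynomial_function q \<and> f = (\<lambda>s. q (\<Phi> s - \<Phi> a)))"
  have "\<exists>g. P g \<and> (\<forall>x\<in>{a..b}. \<bar>z x - g x\<bar> < e)"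
  proof (rule Stone_Weierstrass_HOL[OF _ _ _ _ _ _ assms])
    show "P (\<lambda>x. c)" for c unfolding P_def using real_polynomial_function.intros(2) by blast
    show "continuous_on {a..b} f" if f: "P f" for f
    proof -
      obtain q where q: "real_polynomial_function q" "f = (\<lambda>s. q (\<Phi> s - \<Phi> a))"
        using f unfolding P_def by blast
      then have "continuous_on UNIV q"
        by (simp add: continuous_on_polymonial_function real_polynomial_function_eq)
      then show ?thesis unfolding q(2)
        by (rule continuous_on_compose2) (auto intro: continuous_intros continuous_on_Phi)
    qed
    show "P (\<lambda>x. f x + g x)" if fg: "P f \<and> P g" for f g
    proof -
      obtain p q where "real_polynomial_function p" "f = (\<lambda>s. p (\<Phi> s - \<Phi> a))"
        "real_polynomial_function q" "g = (\<lambda>s. q (\<Phi> s - \<Phi> a))"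
        using fg unfolding P_def by blast
      then show ?thesis unfolding P_def
        by (intro exI[of _ "\<lambda>x. p x + q x"]) (simp add: real_polynomial_function.intros(3))
    qed
    show "P (\<lambda>x. f x * g x)" if fg: "P f \<and> P g" for f g
    proof -
      obtain p q where "real_polynomial_function p" "f = (\<lambda>s. p (\<Phi> s - \<Phi> a))"
        "real_polynomial_function q" "g = (\<lambda>s. q (\<Phi> s - \<Phi> a))"
        using fg unfolding P_def by blast
      then show ?thesis unfolding P_def
        by (intro exI[of _ "\<lambda>x. p x * q x"]) (simp add: real_polynomial_function.intros(4))
    qed
    show "\<exists>f. P f \<and> f x \<noteq> f y" if "x \<in> {a..b} \<and> y \<in> {a..b} \<and> x \<noteq> y" for x y
    proof (intro exI conjI)
      show "P (\<lambda>s. \<Phi> s - \<Phi> a)" unfolding P_def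
        using real_polynomial_function.intros(1)[OF bounded_linear_ident] by blast
      show "\<Phi> x - \<Phi> a \<noteq> \<Phi> y - \<Phi> a"
        using that Phi_less[of x y] Phi_less[of y x] by (cases "x < y") auto
    qed
  qed simp
  then obtain q where q: "real_polynomial_function q" "\<And>s. s \<in> {a..b} \<Longrightarrow> \<bar>z s - q (\<Phi> s - \<Phi> a)\<bar> < e"
    unfolding P_def by auto
  from q(1) obtain p n where "q = (\<lambda>x. \<Sum>i\<le>n. p i * x ^ i)"
    using real_polynomial_function_iff_sum by auto
  with q(2) show ?thesis by (intro that[of p n]) (simp add: Phi_pow_nat)
qed

text \<open>
  On powers of \<open>\<Phi> - \<Phi> a\<close> the law is a cancellation of Gamma factors; density of their linear
  combinations and the boundedness of both sides extend it to all continuous functions.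
\<close>
lemma J_semigroup:
  assumes "0 \<le> \<alpha>" "0 \<le> \<beta>" "\<beta> \<le> 1" "l \<in> {a..b}" and z: "continuous_on {a..b} z"
  shows "J \<alpha> (J \<beta> z) l = J (\<alpha> + \<beta>) z l"
proof -
  define C where "C = J_norm \<alpha> * J_norm \<beta> + J_norm (\<alpha> + \<beta>)"
  have C: "0 \<le> C" unfolding C_def using assms by (simp add: J_norm_nonneg)
  have approx: "\<bar>J \<alpha> (J \<beta> z) l - J (\<alpha> + \<beta>) z l\<bar> \<le> e * C" if e: "0 < e" for e
  proof -
    obtain p n where p: "\<And>s. s \<in> {a..b} \<Longrightarrow> \<bar>z s - (\<Sum>i\<le>n. p i * Phi_pow (real i) s)\<bar> < e"
      using Phi_polynomials_dense[OF z e] by blast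
    define q where "q = (\<lambda>s. \<Sum>i\<le>n. p i * Phi_pow (real i) s)"
    have q_cont: "continuous_on {a..b} q"
      unfolding q_def by (intro continuous_intros continuous_on_Phi_pow) auto
    have Jq: "J \<gamma> q s = (\<Sum>i\<le>n. p i * (Gamma (real i + 1) / Gamma (real i + \<gamma> + 1)) * Phi_pow (real i + \<gamma>) s)"
      if "0 \<le> \<gamma>" "s \<in> {a..b}" for \<gamma> s
      unfolding q_def using that
      by (subst J_sum) (auto simp: J_cmult J_pow mult.assoc intro!: continuous_intros continuous_on_Phi_pow)
    have "J \<alpha> (J \<beta> q) l = J \<alpha> (\<lambda>s. \<Sum>i\<le>n. p i * (Gamma (real i + 1) / Gamma (real i + \<beta> + 1)) * Phi_pow (real i + \<beta>) s) l"
      using assms by (intro J_cong Jq) auto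
    also have "\<dots> = (\<Sum>i\<le>n. p i * (Gamma (real i + 1) / Gamma (real i + \<beta> + 1)) *
         (Gamma (real i + \<beta> + 1) / Gamma (real i + \<beta> + \<alpha> + 1) * Phi_pow (real i + \<beta> + \<alpha>) l))"
      using assms by (subst J_sum) (auto simp only: J_cmult J_pow intro!: continuous_intros continuous_on_Phi_pow)
    also have "\<dots> = J (\<alpha> + \<beta>) q l"
    proof -
      have "0 < Gamma (real i + \<beta> + 1)" for i using assms by (intro Gamma_real_pos) auto
      then have "Gamma (real i + \<beta> + 1) \<noteq> 0" for i by (metis less_irrefl)
      then show ?thesis using assms by (subst Jq) (auto simp: add_ac mult.assoc)
    qed
    finally have semi_q: "J \<alpha> (J \<beta> q) l = J (\<alpha> + \<beta>) q l" .
    let ?d = "\<lambda>s. z s - q s"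
    have d: "continuous_on {a..b} ?d" using z q_cont by (intro continuous_intros)
    have d_le: "\<bar>?d s\<bar> \<le> e" if "s \<in> {a..b}" for s using p[OF that] by (simp add: q_def)
    have "J \<alpha> (J \<beta> z) l - J \<alpha> (J \<beta> q) l = J \<alpha> (J \<beta> ?d) l"
    proof -
      have "J \<alpha> (J \<beta> z) l - J \<alpha> (J \<beta> q) l = J \<alpha> (\<lambda>s. J \<beta> z s - J \<beta> q s) l"
        using assms q_cont by (intro J_diff[symmetric] continuous_on_J) auto
      also have "\<dots> = J \<alpha> (J \<beta> ?d) l"
        using assms q_cont by (intro J_cong J_diff[symmetric]) auto
      finally show ?thesis .
    qed
    also have "\<bar>\<dots>\<bar> \<le> (e * J_norm \<beta>) * J_norm \<alpha>"
      using assms d d_le e by (intro J_bound continuous_on_J mult_nonneg_nonneg J_norm_nonneg) auto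
    finally have 1: "\<bar>J \<alpha> (J \<beta> z) l - J \<alpha> (J \<beta> q) l\<bar> \<le> (e * J_norm \<beta>) * J_norm \<alpha>" .
    have "J (\<alpha> + \<beta>) z l - J (\<alpha> + \<beta>) q l = J (\<alpha> + \<beta>) ?d l"
      using assms q_cont by (intro J_diff[symmetric]) auto
    also have "\<bar>\<dots>\<bar> \<le> e * J_norm (\<alpha> + \<beta>)"
      using assms d d_le e by (intro J_bound) auto
    finally have 2: "\<bar>J (\<alpha> + \<beta>) z l - J (\<alpha> + \<beta>) q l\<bar> \<le> e * J_norm (\<alpha> + \<beta>)" .
    show ?thesis using 1 2 semi_q by (simp add: C_def algebra_simps)
  qed
  have "\<bar>J \<alpha> (J \<beta> z) l - J (\<alpha> + \<beta>) z l\<bar> \<le> 0"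
  proof (rule field_le_epsilon)
    fix e :: real assume e: "0 < e"
    then have "e / (C + 1) * C \<le> e" using C by (simp add: field_simps)
    moreover have "0 < e / (C + 1)" using e C by simp
    note approx[OF this]
    ultimately show "\<bar>J \<alpha> (J \<beta> z) l - J (\<alpha> + \<beta>) z l\<bar> \<le> 0 + e" by linarith
  qed
  then show ?thesis by simp
qed

section \<open>Caputo derivatives as inverses of fractional integrals\<close>

abbreviation D :: "real \<Rightarrow> (real \<Rightarrow> real) \<Rightarrow> real \<Rightarrow> real" where
  "D \<equiv> caputo a b \<Phi>"

lemma J_1: assumes "l \<in> {a..b}" shows "J 1 g l = integral {a..l} (\<lambda>s. \<phi> s * g s)"
proof -
  have "integral {a..l} (\<lambda>s. ker 1 l s * g s) = integral {a..l} (\<lambda>s. \<phi> s * g s)"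
  proof (rule integral_spike[of "{l}"])
    fix s assume "s \<in> {a..l} - {l}"
    then show "\<phi> s * g s = ker 1 l s * g s"
      using Phi_less[of s l] assms by (simp add: ker_def)
  qed simp
  then show ?thesis by (simp add: J_eq)
qed

lemma J_1_has_derivative:
  assumes "l \<in> {a..b}" "continuous_on {a..b} g" "\<And>s. s \<in> {a..b} \<Longrightarrow> H s = J 1 g s"
  shows "(H has_vector_derivative \<phi> l * g l) (at l within {a..b})"
proof (rule has_vector_derivative_transform)
  show "((\<lambda>u. integral {a..u} (\<lambda>s. \<phi> s * g s)) has_vector_derivative \<phi> l * g l) (at l within {a..b})"
    using assms by (intro integral_has_vector_derivative continuous_intros continuous_on_phi)
qed (use assms J_1 in auto)

lemma vector_derivative_J_1:
  assumes "l \<in> {a..b}" "continuous_on {a..b} g" "\<And>s. s \<in> {a..b} \<Longrightarrow> H s = J 1 g s"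
  shows "vector_derivative H (at l within {a..b}) = \<phi> l * g l"
  using vector_derivative_within_closed_interval[OF a_less_b _ J_1_has_derivative[of l g H]] assms by auto

lemma C1_on_J_1:
  assumes "continuous_on {a..b} g" "\<And>s. s \<in> {a..b} \<Longrightarrow> H s = J 1 g s"
  shows "C1_on {a..b} H"
  unfolding C1_on_def
proof
  show "H differentiable_on {a..b}"
    unfolding differentiable_on_def
    using J_1_has_derivative[OF _ assms] differentiableI_vector by blast
  have "continuous_on {a..b} (\<lambda>l. \<phi> l * g l)"
    using assms by (intro continuous_intros continuous_on_phi)
  then show "continuous_on {a..b} (\<lambda>l. vector_derivative H (at l within {a..b}))"
    by (rule continuous_on_eq) (rule vector_derivative_J_1[OF _ assms, symmetric])
qed

text \<open>
  The derivative of \<open>J 1 y\<close> is \<open>\<phi> l * y l\<close> with \<open>\<phi> l > 0\<close>.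
\<close>
lemma J_1_inj:
  assumes "continuous_on {a..b} y" "continuous_on {a..b} z" "l \<in> {a..b}"
    and "\<And>s. s \<in> {a..b} \<Longrightarrow> J 1 y s = J 1 z s"
  shows "y l = z l"
proof -
  have "\<phi> l * y l = \<phi> l * z l"
    using vector_derivative_J_1[of l y "J 1 y"] vector_derivative_J_1[of l z "J 1 y"] assms by simp
  then show ?thesis using phi_pos[of l] assms by simp
qed

lemma C1_on_eq_J_1:
  assumes "C1_on {a..b} H" "H a = 0" "l \<in> {a..b}"
  shows "H l = J 1 (\<lambda>s. vector_derivative H (at s within {a..b}) / \<phi> s) l"
proof -
  let ?H' = "\<lambda>s. vector_derivative H (at s within {a..b})"
  have "(?H' has_integral H l - H a) {a..l}"
  proof (rule fundamental_theorem_of_calculus)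
    fix s assume s: "s \<in> {a..l}"
    then have "(H has_vector_derivative ?H' s) (at s within {a..b})"
      using assms by (simp add: C1_on_def differentiable_on_def vector_derivative_works[symmetric])
    then show "(H has_vector_derivative ?H' s) (at s within {a..l})"
      by (rule has_vector_derivative_within_subset) (use assms in auto)
  qed (use assms in auto)
  then have "H l = integral {a..l} ?H'" using assms by (simp add: integral_unique)
  also have "\<dots> = integral {a..l} (\<lambda>s. \<phi> s * (?H' s / \<phi> s))"
    using assms deriv_Phi_nz by (intro integral_cong) simp
  finally show ?thesis using assms by (simp add: J_1)
qed

text \<open>
  If \<open>z = c + J \<alpha> g\<close>, then \<open>J (1 - \<alpha>) (z - z a) = J 1 g\<close>, whose derivative is \<open>\<phi> * g\<close>.
\<close>
lemma caputoI:
  assumes \<alpha>: "0 < \<alpha>" "\<alpha> \<le> 1" and g: "continuous_on {a..b} g"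
    and z: "\<And>l. l \<in> {a..b} \<Longrightarrow> z l = c + J \<alpha> g l"
  shows "z a = c" "continuous_on {a..b} z" "caputo_continuous a b \<Phi> \<alpha> z"
    "\<And>l. l \<in> {a..b} \<Longrightarrow> D \<alpha> z l = g l"
proof -
  show za: "z a = c" using z[of a] a_less_b \<alpha> by (simp add: J_start)
  have "continuous_on {a..b} (\<lambda>l. c + J \<alpha> g l)"
    using assms by (intro continuous_intros continuous_on_J) auto
  then show "continuous_on {a..b} z" by (rule continuous_on_eq) (simp add: z)
  have H: "J (1 - \<alpha>) (\<lambda>s. z s - z a) l = J 1 g l" if "l \<in> {a..b}" for l
  proof -
    have "J (1 - \<alpha>) (\<lambda>s. z s - z a) l = J (1 - \<alpha>) (J \<alpha> g) l"
      using that by (intro J_cong) (auto simp: z za)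
    also have "\<dots> = J 1 g l" using that assms by (simp add: J_semigroup)
    finally show ?thesis .
  qed
  show "caputo_continuous a b \<Phi> \<alpha> z"
    unfolding caputo_continuous_def using g H by (rule C1_on_J_1)
  show "D \<alpha> z l = g l" if "l \<in> {a..b}" for l
    using vector_derivative_J_1[OF that g H] phi_pos[OF that] by (simp add: caputo_def)
qed

text \<open>
  Conversely, \<open>J (1 - \<alpha>) (z - z a) = J 1 (D \<alpha> z)\<close> by the fundamental theorem of calculus.  Applying
  \<open>J \<alpha>\<close> gives \<open>J 1 (z - z a) = J 1 (J \<alpha> (D \<alpha> z))\<close>, and \<open>J 1\<close> is injective.
\<close>
lemma caputo_representation:
  assumes \<alpha>: "0 < \<alpha>" "\<alpha> \<le> 1" and z: "continuous_on {a..b} z" and C: "caputo_continuous a b \<Phi> \<alpha> z"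
  shows "continuous_on {a..b} (D \<alpha> z)" "\<And>l. l \<in> {a..b} \<Longrightarrow> z l = z a + J \<alpha> (D \<alpha> z) l"
proof -
  let ?y = "\<lambda>s. z s - z a"
  let ?H = "J (1 - \<alpha>) ?y"
  have C1: "C1_on {a..b} ?H" using C by (simp add: caputo_continuous_def)
  have D: "D \<alpha> z = (\<lambda>s. vector_derivative ?H (at s within {a..b}) / \<phi> s)"
    by (simp add: caputo_def fun_eq_iff)
  show cont: "continuous_on {a..b} (D \<alpha> z)"
    using C1 deriv_Phi_nz continuous_on_phi unfolding D C1_on_def by (intro continuous_on_divide) auto
  have y: "continuous_on {a..b} ?y" using z by (intro continuous_intros)
  have Ha: "?H a = 0" by (cases "\<alpha> = 1") (use \<alpha> in \<open>simp_all add: J_start\<close>)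
  have H: "?H l = J 1 (D \<alpha> z) l" if "l \<in> {a..b}" for l
    unfolding D by (rule C1_on_eq_J_1[OF C1 Ha that])
  have eq: "J 1 ?y l = J 1 (J \<alpha> (D \<alpha> z)) l" if l: "l \<in> {a..b}" for l
  proof -
    have "J 1 ?y l = J \<alpha> ?H l"
      using J_semigroup[of \<alpha> "1 - \<alpha>" l ?y] \<alpha> l y by simp
    also have "\<dots> = J \<alpha> (J 1 (D \<alpha> z)) l"
      using l by (intro J_cong H) auto
    also have "\<dots> = J 1 (J \<alpha> (D \<alpha> z)) l"
      using J_semigroup[of \<alpha> 1 l "D \<alpha> z"] J_semigroup[of 1 \<alpha> l "D \<alpha> z"] \<alpha> l cont
      by (simp add: add.commute)
    finally show ?thesis .
  qed
  have "?y l = J \<alpha> (D \<alpha> z) l" if "l \<in> {a..b}" for l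
    by (rule J_1_inj[of ?y "J \<alpha> (D \<alpha> z)", OF y]) (use that eq cont \<alpha> in \<open>auto intro: continuous_on_J\<close>)
  then show "z l = z a + J \<alpha> (D \<alpha> z) l" if "l \<in> {a..b}" for l
    by (metis that add.commute diff_add_cancel)
qed

section \<open>Fractional Volterra equations of the second kind\<close>

text \<open>
  For \<open>\<theta> s = exp (r * (\<Phi> s - \<Phi> a))\<close> the quotient \<open>J \<alpha> \<theta> l / \<theta> l\<close> is an integral with the kernel of
  order \<open>\<alpha>\<close> damped by \<open>exp (- r * x)\<close> at distance \<open>x = \<Phi> l - \<Phi> s\<close>.  The estimate
  \<open>exp (- r * x) \<le> (r * x) powr (- \<gamma>)\<close> trades half of the order of integration, \<open>\<gamma> = \<alpha> / 2\<close>, for the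
  small factor \<open>r powr (- \<gamma>)\<close>.
\<close>
lemma exponential_weight:
  assumes \<alpha>: "0 < \<alpha>" "\<alpha> \<le> 1" and c: "0 \<le> c"
  obtains \<theta> where "continuous_on {a..b} \<theta>" "\<And>l. l \<in> {a..b} \<Longrightarrow> 1 \<le> \<theta> l"
    "\<And>l. l \<in> {a..b} \<Longrightarrow> c * J \<alpha> \<theta> l \<le> \<theta> l / 2"
proof -
  define \<gamma> where "\<gamma> = \<alpha> / 2"
  have \<gamma>: "0 < \<gamma>" "\<gamma> \<le> 1" using \<alpha> by (auto simp: \<gamma>_def)
  have G: "0 < Gamma \<alpha>" using \<alpha> by (simp add: Gamma_real_pos)
  define C where "C = (\<Phi> b - \<Phi> a) powr \<gamma> / \<gamma> / Gamma \<alpha>"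
  have C: "0 \<le> C" using \<gamma> G by (simp add: C_def)
  \<comment> \<open>Chosen such that \<open>c * C / r powr \<gamma> \<le> 1 / 2\<close>.\<close>
  define r where "r = (2 * c * C + 1) powr (1 / \<gamma>)"
  have pos: "0 < 2 * c * C + 1" using c C by (simp add: add_nonneg_pos)
  have r: "0 < r" and r_powr: "r powr \<gamma> = 2 * c * C + 1"
    using pos \<gamma> by (auto simp: r_def powr_powr)
  define \<theta> where "\<theta> = (\<lambda>s. exp (r * (\<Phi> s - \<Phi> a)))"
  have \<theta>_cont: "continuous_on {a..b} \<theta>"
    unfolding \<theta>_def by (intro continuous_intros continuous_on_Phi)
  have "c * J \<alpha> \<theta> l \<le> \<theta> l / 2" if l: "l \<in> {a..b}" for l
  proof -
    have "integral {a..l} (\<lambda>s. ker \<alpha> l s * \<theta> s) \<le> integral {a..l} (\<lambda>s. \<theta> l / r powr \<gamma> * ker \<gamma> l s)"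
    proof (rule integral_le)
      show "(\<lambda>s. ker \<alpha> l s * \<theta> s) integrable_on {a..l}"
        using \<alpha> l \<theta>_cont by (intro integrable_ker_times) auto
      show "(\<lambda>s. \<theta> l / r powr \<gamma> * ker \<gamma> l s) integrable_on {a..l}"
        using has_integral_ker[of \<gamma> a l] \<gamma> l by (intro integrable_on_mult_right) (auto simp: integrable_on_def)
      fix s assume s: "s \<in> {a..l}"
      define x where "x = \<Phi> l - \<Phi> s"
      have x: "0 \<le> x" unfolding x_def using s l by (auto intro: Phi_le)
      have \<theta>s: "\<theta> s = \<theta> l / exp (r * x)"
        by (simp add: \<theta>_def x_def exp_diff[symmetric] algebra_simps)
      have "x powr (\<alpha> - 1) / exp (r * x) \<le> x powr (\<gamma> - 1) / r powr \<gamma>"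
      proof (cases "x = 0")
        case False
        then have x: "0 < x" using x by simp
        have "r powr \<gamma> * x powr \<gamma> \<le> exp (r * x)"
          using powr_le_exp[of "r * x" \<gamma>] x r \<gamma> by (simp add: powr_mult)
        then have "x powr (\<gamma> - 1) * (r powr \<gamma> * x powr \<gamma>) \<le> x powr (\<gamma> - 1) * exp (r * x)"
          by (rule mult_left_mono) simp
        moreover have "x powr (\<alpha> - 1) = x powr (\<gamma> - 1) * x powr \<gamma>"
          by (simp add: \<gamma>_def powr_add[symmetric])
        ultimately show ?thesis using r by (simp add: field_simps)
      qed simp
      then have "\<phi> s * \<theta> l * (x powr (\<alpha> - 1) / exp (r * x)) \<le> \<phi> s * \<theta> l * (x powr (\<gamma> - 1) / r powr \<gamma>)"
        using phi_pos[of s] s l by (intro mult_left_mono) (auto simp: \<theta>_def)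
      then show "ker \<alpha> l s * \<theta> s \<le> \<theta> l / r powr \<gamma> * ker \<gamma> l s"
        by (simp add: ker_def \<theta>s x_def[symmetric] mult_ac)
    qed
    also have "\<dots> = \<theta> l / r powr \<gamma> * ((\<Phi> l - \<Phi> a) powr \<gamma> / \<gamma>)"
      using has_integral_ker[of \<gamma> a l] \<gamma> l by (simp add: integral_unique)
    also have "\<dots> \<le> \<theta> l / r powr \<gamma> * ((\<Phi> b - \<Phi> a) powr \<gamma> / \<gamma>)"
      using l \<gamma> r by (intro mult_left_mono divide_right_mono powr_mono2) (auto intro!: Phi_le simp: \<theta>_def)
    finally have le: "integral {a..l} (\<lambda>s. ker \<alpha> l s * \<theta> s)
        \<le> \<theta> l / r powr \<gamma> * ((\<Phi> b - \<Phi> a) powr \<gamma> / \<gamma>)" .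
    have J: "J \<alpha> \<theta> l = integral {a..l} (\<lambda>s. ker \<alpha> l s * \<theta> s) / Gamma \<alpha>"
      using \<alpha> by (simp add: J_eq)
    have "J \<alpha> \<theta> l \<le> \<theta> l / r powr \<gamma> * ((\<Phi> b - \<Phi> a) powr \<gamma> / \<gamma>) / Gamma \<alpha>"
      unfolding J by (rule divide_right_mono[OF le less_imp_le[OF G]])
    also have "\<dots> = \<theta> l * C / r powr \<gamma>" by (simp add: C_def)
    finally have "c * J \<alpha> \<theta> l \<le> c * (\<theta> l * C / (2 * c * C + 1))"
      unfolding r_powr by (rule mult_left_mono[OF _ c])
    also have "\<dots> = \<theta> l * (c * C / (2 * c * C + 1))" by simp
    also have "\<dots> \<le> \<theta> l * (1 / 2)"
      using pos by (intro mult_left_mono) (auto simp: \<theta>_def divide_le_eq)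
    finally show ?thesis by simp
  qed
  moreover have "1 \<le> \<theta> l" if "l \<in> {a..b}" for l
    using that r Phi_le[of a l] by (simp add: \<theta>_def)
  ultimately show ?thesis using \<theta>_cont by (intro that[of \<theta>]) auto
qed

text \<open>
  Evaluating the inequality where \<open>h / \<theta>\<close> attains its maximum \<open>m\<close> absorbs half of \<open>m * \<theta>\<close> on the left.
  The constant depends on neither \<open>h\<close> nor \<open>e\<close>.
\<close>
lemma fractional_gronwall:
  assumes \<alpha>: "0 < \<alpha>" "\<alpha> \<le> 1" and c: "0 \<le> c"
  shows "\<exists>C\<ge>0. \<forall>h e. continuous_on {a..b} h \<longrightarrow> 0 \<le> e \<longrightarrow> (\<forall>l\<in>{a..b}. h l \<le> e + c * J \<alpha> h l)
           \<longrightarrow> (\<forall>l\<in>{a..b}. h l \<le> C * e)"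
proof -
  obtain \<theta> where \<theta>: "continuous_on {a..b} \<theta>" "\<And>l. l \<in> {a..b} \<Longrightarrow> 1 \<le> \<theta> l"
    "\<And>l. l \<in> {a..b} \<Longrightarrow> c * J \<alpha> \<theta> l \<le> \<theta> l / 2"
    using exponential_weight[OF assms] by blast
  have \<theta>_pos: "0 < \<theta> l" if "l \<in> {a..b}" for l using \<theta>(2)[OF that] by simp
  have ne: "{a..b} \<noteq> {}" using a_less_b by simp
  obtain q where q: "\<And>l. l \<in> {a..b} \<Longrightarrow> \<theta> l \<le> q"
    using continuous_attains_sup[OF compact_Icc ne \<theta>(1)] by blast
  have q1: "1 \<le> q" using q[of a] \<theta>(2)[of a] a_less_b by simp
  have "h l \<le> 2 * q * e"
    if h: "continuous_on {a..b} h" and e: "0 \<le> e" and ineq: "\<And>l. l \<in> {a..b} \<Longrightarrow> h l \<le> e + c * J \<alpha> h l"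
      and l: "l \<in> {a..b}" for h e l
  proof -
    have "continuous_on {a..b} (\<lambda>l. h l / \<theta> l)"
      using h \<theta>(1) less_imp_neq[OF \<theta>_pos] by (intro continuous_on_divide) auto
    then obtain l0 where l0: "l0 \<in> {a..b}" "\<And>l. l \<in> {a..b} \<Longrightarrow> h l / \<theta> l \<le> h l0 / \<theta> l0"
      using continuous_attains_sup[OF compact_Icc ne] by blast
    define m where "m = h l0 / \<theta> l0"
    have h_le: "h l \<le> m * \<theta> l" if "l \<in> {a..b}" for l
      using l0(2)[OF that] \<theta>_pos[OF that] by (simp add: m_def field_simps)
    have "m \<le> 2 * e"
    proof (cases "0 \<le> m")
      case True
      have "J \<alpha> h l0 \<le> J \<alpha> (\<lambda>s. m * \<theta> s) l0"
        using h \<theta>(1) l0(1) h_le \<alpha> by (intro J_mono continuous_intros) auto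
      then have "c * J \<alpha> h l0 \<le> c * (m * J \<alpha> \<theta> l0)"
        unfolding J_cmult by (rule mult_left_mono[OF _ c])
      also have "\<dots> = m * (c * J \<alpha> \<theta> l0)" by simp
      also have "\<dots> \<le> m * (\<theta> l0 / 2)"
        using True \<theta>(3)[OF l0(1)] by (rule mult_left_mono[rotated])
      finally have "c * J \<alpha> h l0 \<le> m * (\<theta> l0 / 2)" .
      moreover have "m * \<theta> l0 = h l0" using \<theta>_pos[OF l0(1)] by (simp add: m_def)
      ultimately have "m * \<theta> l0 \<le> 2 * e" using ineq[OF l0(1)] by simp
      moreover have "m * 1 \<le> m * \<theta> l0" using True \<theta>(2)[OF l0(1)] by (rule mult_left_mono[rotated])
      ultimately show ?thesis by simp
    qed (use e in simp)
    then have "m * \<theta> l \<le> (2 * e) * \<theta> l" using \<theta>_pos[OF l] by (intro mult_right_mono) auto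
    also have "\<dots> \<le> (2 * e) * q" using q[OF l] e by (intro mult_left_mono) auto
    finally show ?thesis using h_le[OF l] by (simp add: mult_ac)
  qed
  then show ?thesis using q1 by (intro exI[of _ "2 * q"]) simp
qed

lemma J_uniform_limit:
  assumes \<alpha>: "0 \<le> \<alpha>" and l: "l \<in> {a..b}"
    and S: "\<And>n. continuous_on {a..b} (S n)" and g: "continuous_on {a..b} g"
    and lim: "uniform_limit {a..b} S g sequentially"
  shows "(\<lambda>n. J \<alpha> (S n) l) \<longlonglongrightarrow> J \<alpha> g l"
proof (rule LIMSEQ_I)
  fix e :: real assume e: "0 < e"
  define d where "d = e / (J_norm \<alpha> + 1)"
  have d: "0 < d" using e J_norm_nonneg[OF \<alpha>] by (simp add: d_def)
  have lt: "d * J_norm \<alpha> < e" using e J_norm_nonneg[OF \<alpha>] by (simp add: d_def field_simps)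
  obtain N where N: "\<And>n s. N \<le> n \<Longrightarrow> s \<in> {a..b} \<Longrightarrow> \<bar>S n s - g s\<bar> < d"
    using uniform_limitD[OF lim d] unfolding eventually_sequentially dist_real_def by blast
  show "\<exists>N. \<forall>n\<ge>N. norm (J \<alpha> (S n) l - J \<alpha> g l) < e"
  proof (intro exI allI impI)
    fix n assume n: "N \<le> n"
    have "J \<alpha> (S n) l - J \<alpha> g l = J \<alpha> (\<lambda>s. S n s - g s) l"
      using \<alpha> l S g by (simp add: J_diff)
    also have "\<bar>\<dots>\<bar> \<le> d * J_norm \<alpha>"
      using \<alpha> l S g N[OF n] d by (intro J_bound continuous_intros) (auto intro: less_imp_le)
    finally show "norm (J \<alpha> (S n) l - J \<alpha> g l) < e" using lt by simp
  qed
qed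

text \<open>
  The Neumann series \<open>d 0 + d 1 + \<dots>\<close> with \<open>d 0 = f\<close> and \<open>d (n + 1) = - c * J \<alpha> (d n)\<close> converges
  because the weight halves each term.
\<close>
lemma volterra_solution_exists:
  assumes \<alpha>: "0 < \<alpha>" "\<alpha> \<le> 1" and c: "0 \<le> c" and f: "continuous_on {a..b} f"
  obtains g where "continuous_on {a..b} g" "\<And>l. l \<in> {a..b} \<Longrightarrow> g l + c * J \<alpha> g l = f l"
proof -
  obtain \<theta> where \<theta>: "continuous_on {a..b} \<theta>" "\<And>l. l \<in> {a..b} \<Longrightarrow> 1 \<le> \<theta> l"
    "\<And>l. l \<in> {a..b} \<Longrightarrow> c * J \<alpha> \<theta> l \<le> \<theta> l / 2"
    using exponential_weight[OF \<alpha> c] by blast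
  have ne: "{a..b} \<noteq> {}" using a_less_b by simp
  obtain q where q: "\<And>l. l \<in> {a..b} \<Longrightarrow> \<theta> l \<le> q"
    using continuous_attains_sup[OF compact_Icc ne \<theta>(1)] by blast
  have "continuous_on {a..b} (\<lambda>l. \<bar>f l\<bar>)" using f by (intro continuous_intros)
  then obtain B where B: "\<And>l. l \<in> {a..b} \<Longrightarrow> \<bar>f l\<bar> \<le> B"
    using continuous_attains_sup[OF compact_Icc ne] by blast
  have B0: "0 \<le> B" using B[of a] a_less_b by force
  define d where "d = (\<lambda>n. ((\<lambda>h l. - c * J \<alpha> h l) ^^ n) f)"
  have d_0: "d 0 = f" and d_Suc: "d (Suc n) = (\<lambda>l. - c * J \<alpha> (d n) l)" for n
    by (simp_all add: d_def)
  have d_cont: "continuous_on {a..b} (d n)" for n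
  proof (induction n)
    case (Suc n)
    then show ?case unfolding d_Suc using \<alpha> by (intro continuous_intros continuous_on_J) auto
  qed (simp add: d_0 f)
  have d_le: "\<bar>d n l\<bar> \<le> B * (1/2) ^ n * \<theta> l" if "l \<in> {a..b}" for n l
    using that
  proof (induction n arbitrary: l)
    case 0
    then show ?case using mult_mono[OF B[of l] \<theta>(2)[of l]] B0 by (simp add: d_0)
  next
    case (Suc n)
    have "\<bar>J \<alpha> (d n) l\<bar> \<le> J \<alpha> (\<lambda>s. B * (1/2) ^ n * \<theta> s) l"
      using Suc \<alpha> d_cont \<theta>(1) by (intro J_abs_le continuous_intros) auto
    then have "c * \<bar>J \<alpha> (d n) l\<bar> \<le> c * (B * (1/2) ^ n * J \<alpha> \<theta> l)"
      unfolding J_cmult by (rule mult_left_mono[OF _ c])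
    also have "\<dots> = B * (1/2) ^ n * (c * J \<alpha> \<theta> l)" by simp
    also have "\<dots> \<le> B * (1/2) ^ n * (\<theta> l / 2)"
      using \<theta>(3)[OF Suc.prems] B0 by (intro mult_left_mono) auto
    finally show ?case using c by (simp add: d_Suc abs_mult)
  qed
  define S where "S = (\<lambda>n l. \<Sum>i<n. d i l)"
  define g where "g = (\<lambda>l. suminf (\<lambda>i. d i l))"
  have S_cont: "continuous_on {a..b} (S n)" for n
    unfolding S_def by (intro continuous_intros d_cont)
  have lim: "uniform_limit {a..b} S g sequentially"
    unfolding S_def g_def
  proof (rule Weierstrass_m_test)
    show "summable (\<lambda>n. B * (1/2) ^ n * q)"
      by (intro summable_mult summable_mult2 summable_geometric) simp
    show "norm (d n l) \<le> B * (1/2) ^ n * q" if "l \<in> {a..b}" for n l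
      using order_trans[OF d_le[OF that] mult_left_mono[OF q[OF that]]] B0 by simp
  qed
  have g_cont: "continuous_on {a..b} g"
    by (rule uniform_limit_theorem[OF _ lim]) (simp_all add: S_cont)
  have "g l + c * J \<alpha> g l = f l" if l: "l \<in> {a..b}" for l
  proof -
    have S_Suc: "S (Suc n) l = f l - c * J \<alpha> (S n) l" for n
    proof -
      have "S (Suc n) l = f l + (\<Sum>i<n. - c * J \<alpha> (d i) l)"
        unfolding S_def by (simp add: sum.lessThan_Suc_shift d_0 d_Suc del: sum.lessThan_Suc)
      also have "(\<Sum>i<n. - c * J \<alpha> (d i) l) = - c * J \<alpha> (S n) l"
        unfolding S_def using \<alpha> l d_cont by (subst J_sum) (auto simp: sum_distrib_left)
      finally show ?thesis by simp
    qed
    have "(\<lambda>n. S (Suc n) l) \<longlonglongrightarrow> g l"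
      using tendsto_uniform_limitI[OF lim l] by (rule LIMSEQ_Suc)
    moreover have "(\<lambda>n. S (Suc n) l) \<longlonglongrightarrow> f l - c * J \<alpha> g l"
      unfolding S_Suc using \<alpha> by (intro tendsto_intros J_uniform_limit[OF _ l S_cont g_cont lim]) auto
    ultimately have "g l = f l - c * J \<alpha> g l" by (rule LIMSEQ_unique)
    then show ?thesis by simp
  qed
  with g_cont show ?thesis by (rule that)
qed

section \<open>Positivity of the Volterra resolvent\<close>

text \<open>
  The integral that defines \<open>J \<alpha> g t\<close>, without the Gamma factor and stopped at time \<open>x\<close>.
\<close>
definition partial :: "real \<Rightarrow> (real \<Rightarrow> real) \<Rightarrow> real \<Rightarrow> real \<Rightarrow> real" where
  "partial \<alpha> g t x = integral {a..x} (\<lambda>s. ker \<alpha> t s * g s)"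

lemma partial_split:
  assumes "0 < \<alpha>" "a \<le> x" "x \<le> y" "y \<le> t" "t \<le> b" "continuous_on {a..b} g"
  shows "partial \<alpha> g t y = partial \<alpha> g t x + integral {x..y} (\<lambda>s. ker \<alpha> t s * g s)"
  unfolding partial_def using assms
  by (intro Henstock_Kurzweil_Integration.integral_combine[symmetric] integrable_ker_times) auto

lemma J_partial: "0 < \<alpha> \<Longrightarrow> J \<alpha> g l = partial \<alpha> g l l / Gamma \<alpha>"
  by (simp add: J_eq partial_def)

text \<open>
  Going from time \<open>\<sigma>\<close> to a later time \<open>t\<close> multiplies the kernel by
  \<open>r s = ((\<Phi> \<sigma> - \<Phi> s) / (\<Phi> t - \<Phi> s)) powr (1 - \<alpha>)\<close>, which is nonnegative and decreasing in \<open>s\<close>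
  (this is log-convexity of the kernel).  By the second mean value theorem the new partial integrals
  are then nonnegative combinations of the old ones.
\<close>
lemma partial_nonneg_later:
  assumes \<alpha>: "0 < \<alpha>" "\<alpha> \<le> 1" and g: "continuous_on {a..b} g"
    and t: "a \<le> \<sigma>" "\<sigma> \<le> t" "t \<le> b" and x: "x \<in> {a..\<sigma>}"
    and Q: "\<And>x. x \<in> {a..\<sigma>} \<Longrightarrow> 0 \<le> partial \<alpha> g \<sigma> x"
  shows "0 \<le> partial \<alpha> g t x"
proof (cases "t = \<sigma>")
  case False
  then have \<sigma>t: "\<Phi> \<sigma> < \<Phi> t" using t by (intro Phi_less) auto
  define r where "r = (\<lambda>s. ((\<Phi> \<sigma> - \<Phi> s) / (\<Phi> t - \<Phi> s)) powr (1 - \<alpha>))"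
  have r_anti: "r v \<le> r u" if "a \<le> u" "u \<le> v" "v \<le> \<sigma>" for u v
  proof -
    have le: "\<Phi> u \<le> \<Phi> v" "\<Phi> v \<le> \<Phi> \<sigma>" using that t by (auto intro: Phi_le)
    then have "0 \<le> (\<Phi> t - \<Phi> \<sigma>) * (\<Phi> v - \<Phi> u)" using \<sigma>t by (intro mult_nonneg_nonneg) auto
    then have "(\<Phi> \<sigma> - \<Phi> v) * (\<Phi> t - \<Phi> u) \<le> (\<Phi> \<sigma> - \<Phi> u) * (\<Phi> t - \<Phi> v)"
      by (simp add: algebra_simps)
    then have "(\<Phi> \<sigma> - \<Phi> v) / (\<Phi> t - \<Phi> v) \<le> (\<Phi> \<sigma> - \<Phi> u) / (\<Phi> t - \<Phi> u)"
      using le \<sigma>t by (simp add: field_simps)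
    then show ?thesis unfolding r_def using le \<sigma>t \<alpha> by (intro powr_mono2) auto
  qed
  let ?f = "\<lambda>s. ker \<alpha> \<sigma> s * g s"
  have f_int: "?f integrable_on {a..x}" using \<alpha> g t x by (intro integrable_ker_times) auto
  obtain c where c: "c \<in> {a..x}"
    "integral {a..x} (\<lambda>s. - r s * ?f s) = - r a * integral {a..c} ?f + - r x * integral {c..x} ?f"
    using second_mean_value_theorem[OF f_int, of "\<lambda>s. - r s"] r_anti x by auto
  have I: "integral {c..x} ?f = partial \<alpha> g \<sigma> x - partial \<alpha> g \<sigma> c"
    using partial_split[of \<alpha> c x \<sigma> g] \<alpha> g t x c by auto
  have "integral {a..x} (\<lambda>s. r s * ?f s) = r a * partial \<alpha> g \<sigma> c + r x * integral {c..x} ?f"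
    using c(2) by (simp add: partial_def)
  also have "\<dots> = (r a - r x) * partial \<alpha> g \<sigma> c + r x * partial \<alpha> g \<sigma> x"
    unfolding I by (simp add: algebra_simps)
  finally have "integral {a..x} (\<lambda>s. r s * ?f s)
      = (r a - r x) * partial \<alpha> g \<sigma> c + r x * partial \<alpha> g \<sigma> x" .
  moreover have "0 \<le> (r a - r x) * partial \<alpha> g \<sigma> c + r x * partial \<alpha> g \<sigma> x"
    using r_anti[of a x] x c Q by (intro add_nonneg_nonneg mult_nonneg_nonneg) (auto simp: r_def)
  moreover have "integral {a..x} (\<lambda>s. r s * ?f s) = partial \<alpha> g t x"
    unfolding partial_def
  proof (rule integral_spike[of "{\<sigma>}"])
    fix s assume s: "s \<in> {a..x} - {\<sigma>}"
    then have "0 < \<Phi> \<sigma> - \<Phi> s" using x t Phi_less[of s \<sigma>] by auto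
    then have "r s * (\<Phi> \<sigma> - \<Phi> s) powr (\<alpha> - 1) = (\<Phi> t - \<Phi> s) powr (\<alpha> - 1)"
      using \<sigma>t by (simp add: r_def powr_divide powr_diff)
    then show "ker \<alpha> t s * g s = r s * ?f s"
      by (simp add: ker_def mult_ac)
  qed simp
  ultimately show ?thesis by simp
qed (use Q x in simp)

text \<open>
  Continuous induction on the times \<open>\<sigma>\<close> at which all partial integrals are nonnegative.  They
  stay nonnegative beyond \<open>\<tau>\<close>: if \<open>g \<tau> > 0\<close>, then only positive mass is added after \<open>\<tau>\<close>; otherwise
  the strict inequality forces \<open>J \<alpha> g \<tau> > 0\<close>, and little mass is moved shortly after \<open>\<tau>\<close>.
\<close>
lemma J_nonneg_of_strict_volterra:
  assumes \<alpha>: "0 < \<alpha>" "\<alpha> \<le> 1" and c: "0 \<le> c" and g: "continuous_on {a..b} g"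
    and pos: "\<And>l. l \<in> {a..b} \<Longrightarrow> 0 < g l + c * J \<alpha> g l" and l: "l \<in> {a..b}"
  shows "0 \<le> J \<alpha> g l"
proof -
  have G: "0 < Gamma \<alpha>" using \<alpha> by (simp add: Gamma_real_pos)
  have J_cont: "continuous_on {a..b} (J \<alpha> g)" using \<alpha> g by (intro continuous_on_J) auto
  define Q where "Q = (\<lambda>\<sigma>. \<forall>x\<in>{a..\<sigma>}. 0 \<le> partial \<alpha> g \<sigma> x)"
  have "Q \<sigma>" if "\<sigma> \<in> {a..b}" for \<sigma>
  proof (rule ccontr)
    assume "\<not> Q \<sigma>"
    define B where "B = {\<sigma> \<in> {a..b}. \<not> Q \<sigma>}"
    have B: "B \<noteq> {}" "bdd_below B" using that \<open>\<not> Q \<sigma>\<close> by (auto simp: B_def)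
    define \<tau> where "\<tau> = Inf B"
    have \<tau>: "\<tau> \<in> {a..b}"
      unfolding \<tau>_def using B cInf_lower[OF _ B(2)] cInf_greatest[OF B(1), of a]
      by (force simp: B_def)
    have before: "Q s" if "a \<le> s" "s < \<tau>" for s
      using that \<tau> cInf_lower[OF _ B(2), of s] by (auto simp: B_def \<tau>_def)
    have Q\<tau>_lt: "0 \<le> partial \<alpha> g \<tau> x" if "x \<in> {a..<\<tau>}" for x
      using partial_nonneg_later[OF \<alpha> g, of x \<tau> x] before[of x] that \<tau> by (auto simp: Q_def)
    have Q\<tau>: "0 \<le> partial \<alpha> g \<tau> x" if x: "x \<in> {a..\<tau>}" for x
    proof (cases "\<tau> = a")
      case True
      then show ?thesis using x by (simp add: partial_def)
    next
      case False
      then have cl: "closure {a..<\<tau>} = {a..\<tau>}" using \<tau> by simp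
      have "continuous_on {a..\<tau>} (partial \<alpha> g \<tau>)"
        unfolding partial_def[abs_def] using \<alpha> g \<tau>
        by (intro indefinite_integral_continuous_1 integrable_ker_times) auto
      then show ?thesis
        using continuous_ge_on_closure[of "{a..<\<tau>}" "partial \<alpha> g \<tau>" x 0] cl Q\<tau>_lt x by simp
    qed
    \<comment> \<open>\<open>Q\<close> holds up to and including \<open>\<tau>\<close>; an extension past \<open>\<tau>\<close> contradicts the choice of \<open>\<tau>\<close>
        as the infimum of the bad times.\<close>
    have "\<exists>\<delta>>0. \<forall>t\<in>{\<tau>..b}. t < \<tau> + \<delta> \<longrightarrow> Q t"
    proof (cases "0 < g \<tau>")
      case True
      then obtain \<delta> where \<delta>: "0 < \<delta>" "\<And>y. y \<in> {a..b} \<Longrightarrow> \<bar>y - \<tau>\<bar> < \<delta> \<Longrightarrow> 0 < g y"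
        using continuous_on_pos_nhd[OF g \<tau>] by blast
      have "Q t" if t: "t \<in> {\<tau>..b}" "t < \<tau> + \<delta>" for t
        unfolding Q_def
      proof
        fix x assume x: "x \<in> {a..t}"
        show "0 \<le> partial \<alpha> g t x"
        proof (cases "x \<le> \<tau>")
          case True
          then show ?thesis using partial_nonneg_later[OF \<alpha> g, of \<tau> t x] Q\<tau> x t \<tau> by auto
        next
          case False
          have "0 \<le> partial \<alpha> g t \<tau>"
            using partial_nonneg_later[OF \<alpha> g, of \<tau> t \<tau>] Q\<tau> t \<tau> by auto
          moreover have "0 \<le> integral {\<tau>..x} (\<lambda>s. ker \<alpha> t s * g s)"
          proof (rule integral_nonneg)
            show "(\<lambda>s. ker \<alpha> t s * g s) integrable_on {\<tau>..x}"
              using \<alpha> g \<tau> t x False by (intro integrable_ker_times) auto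
            fix s assume "s \<in> {\<tau>..x}"
            then show "0 \<le> ker \<alpha> t s * g s"
              using \<delta>(2)[of s] x t \<tau> by (intro mult_nonneg_nonneg ker_nonneg) auto
          qed
          ultimately show ?thesis
            using partial_split[of \<alpha> \<tau> x t g] \<alpha> g \<tau> t x False by auto
        qed
      qed
      with \<delta>(1) show ?thesis by blast
    next
      case False
      then have "0 < c * J \<alpha> g \<tau>" using pos[OF \<tau>] by linarith
      then have J_pos: "0 < J \<alpha> g \<tau>" using c by (simp add: zero_less_mult_iff)
      have "compact (g ` {a..b})" using g by (simp add: compact_continuous_image)
      then obtain K where "\<forall>y\<in>g ` {a..b}. norm y \<le> K"
        using compact_imp_bounded bounded_iff by blast
      then have K: "\<bar>g s\<bar> \<le> K" if "s \<in> {a..b}" for s using that by simp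
      have K0: "0 \<le> K" using K[OF \<tau>] by linarith
      define H where "H = (\<lambda>t. Gamma \<alpha> * J \<alpha> g t - K * ((\<Phi> t - \<Phi> \<tau>) powr \<alpha> / \<alpha>))"
      have sub: "{\<tau>..b} \<subseteq> {a..b}" using \<tau> by auto
      have "continuous_on {\<tau>..b} H"
        unfolding H_def using \<alpha> \<tau> continuous_on_subset[OF J_cont sub] continuous_on_subset[OF continuous_on_Phi sub]
        by (intro continuous_intros continuous_on_powr') (auto intro: Phi_le)
      moreover have "0 < H \<tau>" using J_pos G by (simp add: H_def)
      ultimately obtain \<delta> where \<delta>: "0 < \<delta>" "\<And>y. y \<in> {\<tau>..b} \<Longrightarrow> \<bar>y - \<tau>\<bar> < \<delta> \<Longrightarrow> 0 < H y"
        using continuous_on_pos_nhd[of "{\<tau>..b}" H \<tau>] \<tau> by auto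
      have "Q t" if t: "t \<in> {\<tau>..b}" "t < \<tau> + \<delta>" for t
        unfolding Q_def
      proof
        fix x assume x: "x \<in> {a..t}"
        show "0 \<le> partial \<alpha> g t x"
        proof (cases "x \<le> \<tau>")
          case True
          then show ?thesis using partial_nonneg_later[OF \<alpha> g, of \<tau> t x] Q\<tau> x t \<tau> by auto
        next
          case False
          have "\<bar>integral {x..t} (\<lambda>s. ker \<alpha> t s * g s)\<bar> \<le> integral {x..t} (\<lambda>s. K * ker \<alpha> t s)"
          proof (rule abs_integral_le)
            show "(\<lambda>s. ker \<alpha> t s * g s) integrable_on {x..t}"
              using \<alpha> g \<tau> t x by (intro integrable_ker_times) auto
            show "(\<lambda>s. K * ker \<alpha> t s) integrable_on {x..t}"
              using has_integral_ker[of \<alpha> x t] \<alpha> t x by (intro integrable_on_mult_right) (auto simp: integrable_on_def)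
            fix s assume s: "s \<in> {x..t}"
            then have "s \<in> {a..b}" using x t by auto
            then show "\<bar>ker \<alpha> t s * g s\<bar> \<le> K * ker \<alpha> t s"
              using mult_right_mono[OF K[of s], of "ker \<alpha> t s"] ker_nonneg[of s \<alpha> t]
              by (simp add: abs_mult mult.commute)
          qed
          also have "\<dots> = K * ((\<Phi> t - \<Phi> x) powr \<alpha> / \<alpha>)"
            using has_integral_ker[of \<alpha> x t] \<alpha> t x by (simp add: integral_unique)
          also have "\<dots> \<le> K * ((\<Phi> t - \<Phi> \<tau>) powr \<alpha> / \<alpha>)"
            using K0 \<alpha> x t \<tau> False by (intro mult_left_mono divide_right_mono powr_mono2) (auto intro: Phi_le)
          finally have "integral {x..t} (\<lambda>s. ker \<alpha> t s * g s) \<le> K * ((\<Phi> t - \<Phi> \<tau>) powr \<alpha> / \<alpha>)" by simp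
          moreover have "0 < H t" using \<delta>(2)[OF t(1)] t by simp
          moreover have "Gamma \<alpha> * J \<alpha> g t = partial \<alpha> g t t"
            using less_imp_neq[OF G] \<alpha> by (simp add: J_partial)
          ultimately show ?thesis
            using partial_split[of \<alpha> x t t g] \<alpha> g t x by (auto simp: H_def)
        qed
      qed
      with \<delta>(1) show ?thesis by blast
    qed
    then obtain \<delta> where \<delta>: "0 < \<delta>" "\<And>t. t \<in> {\<tau>..b} \<Longrightarrow> t < \<tau> + \<delta> \<Longrightarrow> Q t" by blast
    obtain t where t: "t \<in> B" "t < \<tau> + \<delta>"
      using cInf_lessD[OF B(1), of "\<tau> + \<delta>"] \<delta>(1) by (auto simp: \<tau>_def)
    have "\<tau> \<le> t" unfolding \<tau>_def using t(1) B(2) by (rule cInf_lower)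
    then show False using \<delta>(2)[of t] t by (auto simp: B_def)
  qed
  from this[OF l] have "0 \<le> partial \<alpha> g l l" using l by (simp add: Q_def)
  then show ?thesis using \<alpha> G by (simp add: J_partial)
qed

text \<open>
  The equation is linear, so \<open>g\<close> can be perturbed by a small multiple of the solution \<open>h\<close> with
  right-hand side \<open>1\<close> to make the inequality strict.
\<close>
lemma J_nonneg_of_volterra:
  assumes \<alpha>: "0 < \<alpha>" "\<alpha> \<le> 1" and c: "0 \<le> c" and g: "continuous_on {a..b} g"
    and nonneg: "\<And>l. l \<in> {a..b} \<Longrightarrow> 0 \<le> g l + c * J \<alpha> g l" and l: "l \<in> {a..b}"
  shows "0 \<le> J \<alpha> g l"
proof (rule ccontr)
  assume neg: "\<not> 0 \<le> J \<alpha> g l"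
  obtain h where h: "continuous_on {a..b} h" "\<And>l. l \<in> {a..b} \<Longrightarrow> h l + c * J \<alpha> h l = 1"
    using volterra_solution_exists[OF \<alpha> c, of "\<lambda>_. 1"] by auto
  define e where "e = - J \<alpha> g l / (\<bar>J \<alpha> h l\<bar> + 1)"
  have e: "0 < e" unfolding e_def using neg by (intro divide_pos_pos) auto
  have gh: "continuous_on {a..b} (\<lambda>s. g s + e * h s)" using g h by (intro continuous_intros)
  have J: "J \<alpha> (\<lambda>s. g s + e * h s) s = J \<alpha> g s + e * J \<alpha> h s" if "s \<in> {a..b}" for s
    using that \<alpha> g h by (subst J_add) (auto simp: J_cmult intro!: continuous_intros)
  have "0 \<le> J \<alpha> (\<lambda>s. g s + e * h s) l"
  proof (rule J_nonneg_of_strict_volterra[OF \<alpha> c gh _ l])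
    fix s assume s: "s \<in> {a..b}"
    have "(g s + e * h s) + c * J \<alpha> (\<lambda>s. g s + e * h s) s
        = (g s + c * J \<alpha> g s) + e * (h s + c * J \<alpha> h s)"
      by (simp add: J[OF s] algebra_simps)
    then show "0 < (g s + e * h s) + c * J \<alpha> (\<lambda>s. g s + e * h s) s"
      using nonneg[OF s] h(2)[OF s] e by simp
  qed
  then have "0 \<le> J \<alpha> g l + e * J \<alpha> h l" using J[OF l] by simp
  moreover have "e * J \<alpha> h l < e * (\<bar>J \<alpha> h l\<bar> + 1)" using e by (intro mult_strict_left_mono) auto
  moreover have "e * (\<bar>J \<alpha> h l\<bar> + 1) = - J \<alpha> g l" by (simp add: e_def)
  ultimately show False by linarith
qed

end

section \<open>The two-term linear problem\<close>

locale two_term = phi_clock +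
  fixes \<mu> \<kappa> \<omega> :: real
  assumes kappa_pos: "0 < \<kappa>" and kappa_less_mu: "\<kappa> < \<mu>" and mu_le_1: "\<mu> \<le> 1" and omega_pos: "0 < \<omega>"
begin

abbreviation L :: "(real \<Rightarrow> real) \<Rightarrow> real \<Rightarrow> real" where
  "L z l \<equiv> D \<mu> z l + \<omega> * D \<kappa> z l"

abbreviation adm :: "(real \<Rightarrow> real) \<Rightarrow> bool" where
  "adm \<equiv> admissible a b \<Phi> \<mu> \<kappa>"

lemma orders: "0 < \<mu> - \<kappa>" "\<mu> - \<kappa> \<le> 1" "0 < \<mu>" "\<mu> \<le> 1" "0 < \<kappa>" "\<kappa> \<le> 1"
  using kappa_pos kappa_less_mu mu_le_1 by auto

lemma J_mu_split:
  assumes "continuous_on {a..b} g" "l \<in> {a..b}"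
  shows "J \<mu> g l = J \<kappa> (J (\<mu> - \<kappa>) g) l"
  using J_semigroup[of \<kappa> "\<mu> - \<kappa>" l g] assms orders by simp

text \<open>
  Here \<open>J \<mu> g = J \<kappa> (J (\<mu> - \<kappa>) g)\<close> yields the derivative of the lower order from that of the
  higher one.
\<close>
lemma admissible_J:
  assumes g: "continuous_on {a..b} g" and z: "\<And>l. l \<in> {a..b} \<Longrightarrow> z l = c + J \<mu> g l"
  shows "adm z" "z a = c"
    "\<And>l. l \<in> {a..b} \<Longrightarrow> D \<mu> z l = g l" "\<And>l. l \<in> {a..b} \<Longrightarrow> D \<kappa> z l = J (\<mu> - \<kappa>) g l"
proof -
  have h: "continuous_on {a..b} (J (\<mu> - \<kappa>) g)" using g orders by (intro continuous_on_J) auto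
  have z': "z l = c + J \<kappa> (J (\<mu> - \<kappa>) g) l" if "l \<in> {a..b}" for l
    using z[OF that] J_mu_split[OF g that] by simp
  show "adm z" using caputoI[OF _ _ g z] caputoI[OF _ _ h z'] orders by (simp add: admissible_def)
  show "z a = c" using caputoI(1)[OF _ _ g z] orders by simp
  show "D \<mu> z l = g l" if "l \<in> {a..b}" for l using caputoI(4)[OF _ _ g z that] orders by simp
  show "D \<kappa> z l = J (\<mu> - \<kappa>) g l" if "l \<in> {a..b}" for l
    using caputoI(4)[OF _ _ h z' that] orders by simp
qed

lemma admissible_representation:
  assumes "adm z"
  shows "continuous_on {a..b} (D \<mu> z)" "\<And>l. l \<in> {a..b} \<Longrightarrow> z l = z a + J \<mu> (D \<mu> z) l"
    "\<And>l. l \<in> {a..b} \<Longrightarrow> L z l = D \<mu> z l + \<omega> * J (\<mu> - \<kappa>) (D \<mu> z) l"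
    "continuous_on {a..b} (L z)"
proof -
  have z: "continuous_on {a..b} z" "caputo_continuous a b \<Phi> \<mu> z"
    using assms by (simp_all add: admissible_def)
  note rep = caputo_representation[OF orders(3,4) z]
  show g: "continuous_on {a..b} (D \<mu> z)" by (rule rep(1))
  show "z l = z a + J \<mu> (D \<mu> z) l" if "l \<in> {a..b}" for l using that by (rule rep(2))
  show L: "L z l = D \<mu> z l + \<omega> * J (\<mu> - \<kappa>) (D \<mu> z) l" if "l \<in> {a..b}" for l
    using admissible_J(4)[OF g rep(2) that] by simp
  have "continuous_on {a..b} (\<lambda>l. D \<mu> z l + \<omega> * J (\<mu> - \<kappa>) (D \<mu> z) l)"
    using g orders by (intro continuous_intros continuous_on_J) auto
  then show "continuous_on {a..b} (L z)" by (rule continuous_on_eq) (rule L[symmetric])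
qed

lemma linear_problem_exists:
  assumes "continuous_on {a..b} f"
  obtains z where "adm z" "\<And>l. l \<in> {a..b} \<Longrightarrow> L z l = f l" "z a = c"
proof -
  obtain g where g: "continuous_on {a..b} g" "\<And>l. l \<in> {a..b} \<Longrightarrow> g l + \<omega> * J (\<mu> - \<kappa>) g l = f l"
    using volterra_solution_exists[OF _ _ _ assms, of "\<mu> - \<kappa>" \<omega>] orders omega_pos by auto
  define z where "z = (\<lambda>l. c + J \<mu> g l)"
  have "z l = c + J \<mu> g l" for l by (simp add: z_def)
  from admissible_J[OF g(1) this] g(2) show ?thesis by (intro that[of z]) auto
qed

lemma difference_representation:
  assumes "adm y" "adm z"
  defines "g \<equiv> \<lambda>s. D \<mu> z s - D \<mu> y s"
  shows "continuous_on {a..b} g"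
    "\<And>l. l \<in> {a..b} \<Longrightarrow> g l + \<omega> * J (\<mu> - \<kappa>) g l = L z l - L y l"
    "\<And>l. l \<in> {a..b} \<Longrightarrow> z l - y l = (z a - y a) + J \<mu> g l"
proof -
  note y = admissible_representation[OF assms(1)] and z = admissible_representation[OF assms(2)]
  show "continuous_on {a..b} g" unfolding g_def using y(1) z(1) by (intro continuous_on_diff)
  show "g l + \<omega> * J (\<mu> - \<kappa>) g l = L z l - L y l" if l: "l \<in> {a..b}" for l
    unfolding y(3)[OF l] z(3)[OF l] g_def J_diff[OF less_imp_le[OF orders(1)] l z(1) y(1)]
    by (simp add: right_diff_distrib)
  show "z l - y l = (z a - y a) + J \<mu> g l" if l: "l \<in> {a..b}" for l
    unfolding g_def J_diff[OF less_imp_le[OF orders(3)] l z(1) y(1)]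
    using y(2)[OF l] z(2)[OF l] by linarith
qed

text \<open>
  The Volterra equation for the difference of the derivatives of order \<open>\<mu>\<close> has a nonnegative
  right-hand side, so positivity of its resolvent applies before the monotone \<open>J \<kappa>\<close>.  The second
  part drops the nonnegative lower-order term.
\<close>
lemma comparison:
  assumes "adm y" "adm z" "y a \<le> z a" and le: "\<And>l. l \<in> {a..b} \<Longrightarrow> L y l \<le> L z l"
    and l: "l \<in> {a..b}"
  shows "y l \<le> z l"
    and "y a = z a \<Longrightarrow> z l - y l \<le> J \<mu> (\<lambda>s. L z s - L y s) l"
proof -
  let ?g = "\<lambda>s. D \<mu> z s - D \<mu> y s"
  note g = difference_representation[OF assms(1,2)]
  have Jg: "0 \<le> J (\<mu> - \<kappa>) ?g l" if "l \<in> {a..b}" for l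
  proof (rule J_nonneg_of_volterra[OF orders(1,2) less_imp_le[OF omega_pos] g(1) _ that])
    show "0 \<le> ?g s + \<omega> * J (\<mu> - \<kappa>) ?g s" if "s \<in> {a..b}" for s
      unfolding g(2)[OF that] using le[OF that] by simp
  qed
  have "J \<kappa> (\<lambda>_. 0) l \<le> J \<kappa> (J (\<mu> - \<kappa>) ?g) l"
    using l Jg orders g(1) by (intro J_mono continuous_on_J) auto
  then have "0 \<le> J \<mu> ?g l" using J_mu_split[OF g(1) l] by simp
  then show "y l \<le> z l" using g(3)[OF l] assms(3) by linarith
  assume "y a = z a"
  then have "z l - y l = J \<mu> ?g l" using g(3)[OF l] by simp
  also have "\<dots> \<le> J \<mu> (\<lambda>s. L z s - L y s) l"
  proof (rule J_mono)
    fix s assume s: "s \<in> {a..l}"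
    then have s: "s \<in> {a..b}" using l by auto
    then have "0 \<le> \<omega> * J (\<mu> - \<kappa>) ?g s" using Jg omega_pos by simp
    then show "?g s \<le> L z s - L y s" using g(2)[OF s] by linarith
  next
    show "continuous_on {a..b} (\<lambda>s. L z s - L y s)"
      by (rule continuous_on_diff[OF admissible_representation(4) admissible_representation(4)]) fact+
  qed (use l g(1) orders in auto)
  finally show "z l - y l \<le> J \<mu> (\<lambda>s. L z s - L y s) l" .
qed

lemma volterra_stable:
  shows "\<exists>C\<ge>0. \<forall>g e. continuous_on {a..b} g \<longrightarrow> (\<forall>l\<in>{a..b}. \<bar>g l + \<omega> * J (\<mu> - \<kappa>) g l\<bar> \<le> e)
     \<longrightarrow> (\<forall>l\<in>{a..b}. \<bar>g l\<bar> \<le> C * e)"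
proof -
  obtain C where C: "0 \<le> C" "\<And>h e. continuous_on {a..b} h \<Longrightarrow> 0 \<le> e \<Longrightarrow>
      \<forall>l\<in>{a..b}. h l \<le> e + \<omega> * J (\<mu> - \<kappa>) h l \<Longrightarrow> \<forall>l\<in>{a..b}. h l \<le> C * e"
    using fractional_gronwall[OF orders(1,2) less_imp_le[OF omega_pos]] by blast
  have "\<forall>l\<in>{a..b}. \<bar>g l\<bar> \<le> C * e"
    if g: "continuous_on {a..b} g" and le: "\<forall>l\<in>{a..b}. \<bar>g l + \<omega> * J (\<mu> - \<kappa>) g l\<bar> \<le> e" for g e
  proof (rule C(2))
    show abs_g: "continuous_on {a..b} (\<lambda>l. \<bar>g l\<bar>)" using g by (intro continuous_intros)
    show "0 \<le> e" using bspec[OF le, of a] a_less_b by simp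
    show "\<forall>t\<in>{a..b}. \<bar>g t\<bar> \<le> e + \<omega> * J (\<mu> - \<kappa>) (\<lambda>l. \<bar>g l\<bar>) t"
    proof
      fix t assume t: "t \<in> {a..b}"
      have "\<bar>J (\<mu> - \<kappa>) g t\<bar> \<le> J (\<mu> - \<kappa>) (\<lambda>l. \<bar>g l\<bar>) t"
        using orders t g abs_g by (intro J_abs_le) auto
      then have "\<bar>\<omega> * J (\<mu> - \<kappa>) g t\<bar> \<le> \<omega> * J (\<mu> - \<kappa>) (\<lambda>l. \<bar>g l\<bar>) t"
        using omega_pos by (simp add: abs_mult)
      then show "\<bar>g t\<bar> \<le> e + \<omega> * J (\<mu> - \<kappa>) (\<lambda>l. \<bar>g l\<bar>) t"
        using bspec[OF le t] by linarith
    qed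
  qed
  then show ?thesis using C(1) by blast
qed

text \<open>
  Continuous dependence of the linear problem on its right-hand side.
\<close>
lemma linear_problem_limit:
  assumes u: "\<And>n. adm (u n)" and z: "adm z" and init: "\<And>n. u n a = z a"
    and lim: "uniform_limit {a..b} (\<lambda>n. L (u n)) (L z) sequentially" and l: "l \<in> {a..b}"
  shows "(\<lambda>n. u n l) \<longlonglongrightarrow> z l"
proof -
  obtain C where C: "0 \<le> C" "\<And>g e. continuous_on {a..b} g \<Longrightarrow>
      \<forall>l\<in>{a..b}. \<bar>g l + \<omega> * J (\<mu> - \<kappa>) g l\<bar> \<le> e \<Longrightarrow> \<forall>l\<in>{a..b}. \<bar>g l\<bar> \<le> C * e"
    using volterra_stable by blast
  define g where "g = (\<lambda>n s. D \<mu> (u n) s - D \<mu> z s)"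
  note rep = difference_representation[OF z u, folded g_def]
  have g_cont: "continuous_on {a..b} (g n)" for n using rep(1)[of n] by (simp add: g_def)
  have "uniform_limit {a..b} g (\<lambda>_. 0) sequentially"
  proof (rule uniform_limitI)
    fix e :: real assume e: "0 < e"
    define d where "d = e / (C + 1)"
    have d: "0 < d" and Cd: "C * d < e" using e C(1) by (auto simp: d_def field_simps)
    show "\<forall>\<^sub>F n in sequentially. \<forall>x\<in>{a..b}. dist (g n x) 0 < e"
      using uniform_limitD[OF lim d]
    proof eventually_elim
      case (elim n)
      have "\<forall>x\<in>{a..b}. \<bar>g n x\<bar> \<le> C * d"
      proof (rule C(2)[OF g_cont], rule)
        fix t assume t: "t \<in> {a..b}"
        then show "\<bar>g n t + \<omega> * J (\<mu> - \<kappa>) (g n) t\<bar> \<le> d"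
          using rep(2)[OF t, of n] bspec[OF elim t] by (simp add: g_def dist_real_def)
      qed
      then show ?case using Cd by (force simp: dist_real_def)
    qed
  qed
  then have "(\<lambda>n. J \<mu> (g n) l) \<longlonglongrightarrow> J \<mu> (\<lambda>_. 0) l"
    using orders l g_cont by (intro J_uniform_limit) auto
  moreover have "u n l = z l + J \<mu> (g n) l" for n
    using rep(3)[OF l, of n] init by (simp add: g_def)
  ultimately show ?thesis
    using tendsto_add[OF tendsto_const, of "\<lambda>n. J \<mu> (g n) l" 0 sequentially "z l"] by simp
qed

text \<open>
  The constant is the same for all functions: a bound on \<open>L z\<close> bounds \<open>D \<mu> z\<close> by stability of the
  Volterra equation, and \<open>J \<mu>\<close> turns this into a Hoelder bound on \<open>z\<close>.
\<close>
lemma admissible_modulus: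
  shows "\<exists>C\<ge>0. \<forall>z K. adm z \<longrightarrow> (\<forall>l\<in>{a..b}. \<bar>L z l\<bar> \<le> K) \<longrightarrow>
           (\<forall>t\<in>{a..b}. \<forall>u\<in>{a..b}. \<bar>z u - z t\<bar> \<le> C * K * \<bar>\<Phi> u - \<Phi> t\<bar> powr \<mu>)"
proof -
  obtain C where C: "0 \<le> C" "\<And>g e. continuous_on {a..b} g \<Longrightarrow>
      \<forall>l\<in>{a..b}. \<bar>g l + \<omega> * J (\<mu> - \<kappa>) g l\<bar> \<le> e \<Longrightarrow> \<forall>l\<in>{a..b}. \<bar>g l\<bar> \<le> C * e"
    using volterra_stable by blast
  have G: "0 < Gamma (\<mu> + 1)" using orders by (intro Gamma_real_pos) auto
  define B where "B = 2 * C / Gamma (\<mu> + 1)"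
  have B: "0 \<le> B" using C(1) G by (simp add: B_def)
  have "\<bar>z u - z t\<bar> \<le> B * K * \<bar>\<Phi> u - \<Phi> t\<bar> powr \<mu>"
    if z: "adm z" and K: "\<forall>l\<in>{a..b}. \<bar>L z l\<bar> \<le> K" and t: "t \<in> {a..b}" and u: "u \<in> {a..b}" for z K t u
  proof -
    note rep = admissible_representation[OF z]
    have "\<forall>l\<in>{a..b}. \<bar>D \<mu> z l\<bar> \<le> C * K"
    proof (rule C(2)[OF rep(1)], rule)
      show "\<bar>D \<mu> z s + \<omega> * J (\<mu> - \<kappa>) (D \<mu> z) s\<bar> \<le> K" if "s \<in> {a..b}" for s
        using bspec[OF K that] rep(3)[OF that] by simp
    qed
    then have g: "\<bar>D \<mu> z l\<bar> \<le> C * K" if "l \<in> {a..b}" for l using that by blast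
    have *: "\<bar>z u - z t\<bar> \<le> B * K * \<bar>\<Phi> u - \<Phi> t\<bar> powr \<mu>"
      if "t \<in> {a..b}" "u \<in> {a..b}" "t \<le> u" for t u
    proof -
      have "z u - z t = J \<mu> (D \<mu> z) u - J \<mu> (D \<mu> z) t"
        using rep(2)[OF that(1)] rep(2)[OF that(2)] by linarith
      also have "\<bar>\<dots>\<bar> \<le> 2 * (C * K) / Gamma (\<mu> + 1) * (\<Phi> u - \<Phi> t) powr \<mu>"
        using that by (intro J_modulus[OF orders(3,4) _ _ _ rep(1) g]) auto
      finally show ?thesis using Phi_le[of t u] that by (simp add: B_def)
    qed
    show ?thesis
      using *[OF t u] *[OF u t] by (cases "t \<le> u") (simp_all add: abs_minus_commute)
  qed
  then show ?thesis using B by blast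
qed

end

section \<open>Monotone iteration in the sector\<close>

locale sector_problem = two_term +
  fixes F :: "real \<Rightarrow> real \<Rightarrow> real" and za :: real and z0 w0 :: "real \<Rightarrow> real"
  assumes F_cont: "continuous_on ({a..b} \<times> UNIV) (\<lambda>(l, x). F l x)"
    and lower: "lower_solution a b \<Phi> \<mu> \<kappa> \<omega> F za z0"
    and upper: "upper_solution a b \<Phi> \<mu> \<kappa> \<omega> F za w0"
    and ordered: "\<forall>l\<in>{a..b}. z0 l \<le> w0 l"
    and F_mono: "\<forall>l\<in>{a..b}. \<forall>x y. z0 l \<le> x \<and> x \<le> y \<and> y \<le> w0 l \<longrightarrow> F l x \<le> F l y"
begin

abbreviation sect :: "(real \<Rightarrow> real) set" where "sect \<equiv> sector a b z0 w0"

abbreviation sol :: "(real \<Rightarrow> real \<Rightarrow> real) \<Rightarrow> (real \<Rightarrow> real) \<Rightarrow> bool" where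
  "sol G \<equiv> solution a b \<Phi> \<mu> \<kappa> \<omega> G za"

lemma sol_cont: "sol G z \<Longrightarrow> continuous_on {a..b} z"
  by (simp add: solution_def admissible_def)

lemma sector_bounds: "u \<in> sect \<Longrightarrow> l \<in> {a..b} \<Longrightarrow> z0 l \<le> u l \<and> u l \<le> w0 l"
  by (simp add: sector_def)

lemma sector_cont: "u \<in> sect \<Longrightarrow> continuous_on {a..b} u"
  by (simp add: sector_def)

lemma z0_sector: "z0 \<in> sect" and w0_sector: "w0 \<in> sect"
  using lower upper ordered by (auto simp: sector_def lower_solution_def upper_solution_def admissible_def)

lemma F_comp_cont:
  assumes "continuous_on {a..b} u" shows "continuous_on {a..b} (\<lambda>l. F l (u l))"
proof -
  have "continuous_on {a..b} (\<lambda>l. (l, u l))" using assms by (intro continuous_intros)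
  from continuous_on_compose2[OF F_cont this] show ?thesis by auto
qed

text \<open>
  The linear problem determines its solution on \<open>{a..b}\<close> only, so a choice is needed to obtain a
  total function.
\<close>
definition step :: "(real \<Rightarrow> real) \<Rightarrow> real \<Rightarrow> real" where
  "step u = (SOME z. sol (\<lambda>l _. F l (u l)) z)"

lemma step: assumes "continuous_on {a..b} u" shows "sol (\<lambda>l _. F l (u l)) (step u)"
proof -
  obtain z where "adm z" "\<And>l. l \<in> {a..b} \<Longrightarrow> L z l = F l (u l)" "z a = za"
    using linear_problem_exists[OF F_comp_cont[OF assms], of za] by blast
  then have "sol (\<lambda>l _. F l (u l)) z" by (simp add: solution_def)
  then show ?thesis unfolding step_def
    by (rule someI[of "sol (\<lambda>l _. F l (u l))"])
qed

lemma sol_comparison: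
  assumes "sol G y" "sol H z" "\<And>l. l \<in> {a..b} \<Longrightarrow> G l (y l) \<le> H l (z l)" "l \<in> {a..b}"
  shows "y l \<le> z l"
  by (rule comparison(1)[OF _ _ _ _ assms(4)]) (use assms(1-3) in \<open>simp_all add: solution_def\<close>)

lemma linear_sol_unique:
  assumes "sol (\<lambda>l _. f l) z" shows "unique_solution a b \<Phi> \<mu> \<kappa> \<omega> (\<lambda>l _. f l) za z"
  unfolding unique_solution_def
proof (intro conjI allI impI ballI)
  fix u l assume u: "sol (\<lambda>l _. f l) u" and l: "l \<in> {a..b}"
  show "u l = z l"
    using sol_comparison[OF u assms order_refl l] sol_comparison[OF assms u order_refl l] by simp
qed (rule assms)

text \<open>
  On the sector \<open>F\<close> is monotone, so the right-hand sides of the two linear problems are ordered.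
\<close>
lemma step_mono:
  assumes "u \<in> sect" "v \<in> sect" "\<And>l. l \<in> {a..b} \<Longrightarrow> u l \<le> v l" "l \<in> {a..b}"
  shows "step u l \<le> step v l"
  using step[OF sector_cont[OF assms(1)]] step[OF sector_cont[OF assms(2)]]
proof (rule sol_comparison[OF _ _ _ assms(4)])
  show "F l (u l) \<le> F l (v l)" if "l \<in> {a..b}" for l
    using F_mono assms(3)[OF that] sector_bounds[OF assms(1) that] sector_bounds[OF assms(2) that] that by blast
qed

lemma lower_le_step: assumes "l \<in> {a..b}" shows "z0 l \<le> step z0 l"
  by (rule comparison(1)[OF _ _ _ _ assms])
    (use lower step[OF sector_cont[OF z0_sector]] in \<open>simp_all add: lower_solution_def solution_def\<close>)

lemma step_le_upper: assumes "l \<in> {a..b}" shows "step w0 l \<le> w0 l"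
  by (rule comparison(1)[OF _ _ _ _ assms])
    (use upper step[OF sector_cont[OF w0_sector]] in \<open>simp_all add: upper_solution_def solution_def\<close>)

lemma step_sector: assumes u: "u \<in> sect" shows "step u \<in> sect"
  unfolding sector_def
proof (intro CollectI conjI ballI)
  show "continuous_on {a..b} (step u)" using step[OF sector_cont[OF u]] by (rule sol_cont)
  fix l assume l: "l \<in> {a..b}"
  show "z0 l \<le> step u l"
    using lower_le_step[OF l] step_mono[OF z0_sector u _ l] sector_bounds[OF u] by force
  show "step u l \<le> w0 l"
    using step_le_upper[OF l] step_mono[OF u w0_sector _ l] sector_bounds[OF u] by force
qed

lemma step_fixes_sol:
  assumes "sol F u" "l \<in> {a..b}" shows "step u l = u l"
proof (rule antisym)
  note s = step[OF sol_cont[OF assms(1)]]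
  show "step u l \<le> u l" by (rule sol_comparison[OF s assms(1) order_refl assms(2)])
  show "u l \<le> step u l" by (rule sol_comparison[OF assms(1) s order_refl assms(2)])
qed

definition iter :: "(real \<Rightarrow> real) \<Rightarrow> nat \<Rightarrow> real \<Rightarrow> real" where
  "iter u n = (step ^^ n) u"

lemma iter_0 [simp]: "iter u 0 = u" and iter_Suc [simp]: "iter u (Suc n) = step (iter u n)"
  by (simp_all add: iter_def)

lemma iter_sector: "u \<in> sect \<Longrightarrow> iter u n \<in> sect"
  by (induction n) (auto intro: step_sector)

lemma iter_sequence:
  assumes "u \<in> sect" shows "iterative_sequence a b \<Phi> \<mu> \<kappa> \<omega> F za u (iter u)"
  unfolding iterative_sequence_def
  using linear_sol_unique step[OF sector_cont[OF iter_sector[OF assms]]] by simp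

lemma iter_mono:
  assumes "u \<in> sect" "v \<in> sect" "\<And>l. l \<in> {a..b} \<Longrightarrow> u l \<le> v l"
  shows "l \<in> {a..b} \<Longrightarrow> iter u n l \<le> iter v n l"
proof (induction n arbitrary: l)
  case (Suc n)
  then show ?case using step_mono[OF iter_sector[OF assms(1)] iter_sector[OF assms(2)]] by simp
qed (use assms in simp)

lemma iter_step: "iter (step u) n = step (iter u n)"
  unfolding iter_def by (metis comp_apply funpow_swap1)

lemma iter_lower_incseq: "l \<in> {a..b} \<Longrightarrow> incseq (\<lambda>n. iter z0 n l)"
  using iter_mono[OF z0_sector step_sector[OF z0_sector] lower_le_step]
  by (intro incseq_SucI) (simp add: iter_step)

lemma iter_upper_decseq: "l \<in> {a..b} \<Longrightarrow> decseq (\<lambda>n. iter w0 n l)"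
  using iter_mono[OF step_sector[OF w0_sector] w0_sector step_le_upper]
  by (intro decseq_SucI) (simp add: iter_step)

lemma iter_sol:
  assumes "sol F u" "u \<in> sect" shows "l \<in> {a..b} \<Longrightarrow> iter u n l = u l"
proof (induction n arbitrary: l)
  case (Suc n)
  then have "step (iter u n) l = step u l"
    using step_mono[OF iter_sector[OF assms(2)] assms(2)] step_mono[OF assms(2) iter_sector[OF assms(2)]]
    by (simp add: antisym)
  with step_fixes_sol[OF assms(1) Suc.prems] show ?case by simp
qed simp

lemma sector_F_bounded: "\<exists>K. \<forall>u\<in>sect. \<forall>l\<in>{a..b}. \<bar>F l (u l)\<bar> \<le> K"
proof -
  have bound: "\<exists>K. \<forall>l\<in>{a..b}. \<bar>F l (v l)\<bar> \<le> K" if "v \<in> sect" for v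
  proof -
    have "continuous_on {a..b} (\<lambda>l. \<bar>F l (v l)\<bar>)"
      using F_comp_cont[OF sector_cont[OF that]] by (intro continuous_intros)
    then show ?thesis
      using continuous_attains_sup[of "{a..b}" "\<lambda>l. \<bar>F l (v l)\<bar>"] a_less_b by auto
  qed
  obtain K where K: "\<forall>l\<in>{a..b}. \<bar>F l (z0 l)\<bar> \<le> K" using bound[OF z0_sector] by blast
  obtain K' where K': "\<forall>l\<in>{a..b}. \<bar>F l (w0 l)\<bar> \<le> K'" using bound[OF w0_sector] by blast
  have "\<bar>F l (u l)\<bar> \<le> max K K'" if u: "u \<in> sect" and l: "l \<in> {a..b}" for u l
  proof -
    have "F l (z0 l) \<le> F l (u l)" "F l (u l) \<le> F l (w0 l)"
      using F_mono sector_bounds[OF u l] l by blast+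
    then show ?thesis using bspec[OF K l] bspec[OF K' l] by linarith
  qed
  then show ?thesis by blast
qed

lemma iter_uniform_limit_of_pointwise:
  assumes u: "u \<in> sect" and lim: "\<And>l. l \<in> {a..b} \<Longrightarrow> (\<lambda>n. iter u n l) \<longlonglongrightarrow> v l"
  shows "uniform_limit {a..b} (iter u) v sequentially"
proof -
  obtain K where K: "\<forall>u\<in>sect. \<forall>l\<in>{a..b}. \<bar>F l (u l)\<bar> \<le> K"
    using sector_F_bounded by blast
  obtain C where C: "\<forall>z K. adm z \<longrightarrow> (\<forall>l\<in>{a..b}. \<bar>L z l\<bar> \<le> K) \<longrightarrow>
           (\<forall>t\<in>{a..b}. \<forall>u\<in>{a..b}. \<bar>z u - z t\<bar> \<le> C * K * \<bar>\<Phi> u - \<Phi> t\<bar> powr \<mu>)"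
    using admissible_modulus by blast
  have modulus: "\<bar>iter u (Suc n) y - iter u (Suc n) x\<bar> \<le> C * K * \<bar>\<Phi> y - \<Phi> x\<bar> powr \<mu>"
    if "x \<in> {a..b}" "y \<in> {a..b}" for n x y
  proof -
    have "sol (\<lambda>l _. F l (iter u n l)) (iter u (Suc n))"
      using step[OF sector_cont[OF iter_sector[OF u]]] by simp
    then have "adm (iter u (Suc n))" "\<forall>l\<in>{a..b}. \<bar>L (iter u (Suc n)) l\<bar> \<le> K"
      using bspec[OF K iter_sector[OF u]] by (auto simp: solution_def)
    then show ?thesis using C that by blast
  qed
  have "uniform_limit {a..b} (\<lambda>n. iter u (Suc n)) v sequentially"
  proof (rule equicontinuous_pointwise_imp_uniform_limit)
    fix e :: real assume e: "0 < e"
    have "continuous_on ({a..b} \<times> {a..b}) (\<lambda>p. C * K * \<bar>\<Phi> (snd p) - \<Phi> (fst p)\<bar> powr \<mu>)"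
      using orders
      by (intro continuous_intros continuous_on_powr' continuous_on_compose2[OF continuous_on_Phi]) auto
    then have "uniformly_continuous_on ({a..b} \<times> {a..b}) (\<lambda>p. C * K * \<bar>\<Phi> (snd p) - \<Phi> (fst p)\<bar> powr \<mu>)"
      by (intro compact_uniformly_continuous compact_Times) auto
    then obtain d where d: "0 < d" "\<And>p q. p \<in> {a..b} \<times> {a..b} \<Longrightarrow> q \<in> {a..b} \<times> {a..b} \<Longrightarrow> dist q p < d \<Longrightarrow>
        dist (C * K * \<bar>\<Phi> (snd q) - \<Phi> (fst q)\<bar> powr \<mu>) (C * K * \<bar>\<Phi> (snd p) - \<Phi> (fst p)\<bar> powr \<mu>) < e"
      unfolding uniformly_continuous_on_def using e by meson
    have "dist (iter u (Suc n) x) (iter u (Suc n) y) < e"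
      if "x \<in> {a..b}" "y \<in> {a..b}" "dist x y < d" for n x y
    proof -
      have "\<bar>C * K * \<bar>\<Phi> y - \<Phi> x\<bar> powr \<mu>\<bar> < e"
        using d(2)[of "(x, x)" "(x, y)"] that by (simp add: dist_Pair_Pair dist_commute dist_real_def)
      then show ?thesis using modulus[OF that(1,2), of n] by (simp add: dist_real_def abs_minus_commute)
    qed
    with d(1) show "\<exists>d>0. \<forall>n. \<forall>x\<in>{a..b}. \<forall>y\<in>{a..b}. dist x y < d \<longrightarrow>
        dist (iter u (Suc n) x) (iter u (Suc n) y) < e" by blast
  next
    show "(\<lambda>n. iter u (Suc n) l) \<longlonglongrightarrow> v l" if "l \<in> {a..b}" for l
      using lim[OF that] by (rule LIMSEQ_Suc)
  qed simp
  then show ?thesis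
    by (rule filterlim_sequentially_Suc[THEN iffD1])
qed

text \<open>
  Both iterations are covered by one argument, in which only the convergence of bounded monotone
  sequences of reals depends on the direction.
\<close>
lemma iter_limit_solution:
  assumes u: "u \<in> sect" and mono: "\<And>l. l \<in> {a..b} \<Longrightarrow> monoseq (\<lambda>n. iter u n l)"
  obtains z where "z \<in> sect" "sol F z" "uniform_limit {a..b} (iter u) z sequentially"
proof -
  have bounds: "z0 l \<le> iter u n l" "iter u n l \<le> w0 l" if "l \<in> {a..b}" for n l
    using sector_bounds[OF iter_sector[OF u] that] by auto
  have "convergent (\<lambda>n. iter u n l)" if l: "l \<in> {a..b}" for l
  proof (rule Bseq_monoseq_convergent[OF _ mono[OF l]])
    show "Bseq (\<lambda>n. iter u n l)"
    proof (rule BseqI')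
      show "norm (iter u n l) \<le> \<bar>z0 l\<bar> + \<bar>w0 l\<bar>" for n
        using bounds[OF l, of n] unfolding real_norm_def by linarith
    qed
  qed
  then obtain v where v: "\<And>l. l \<in> {a..b} \<Longrightarrow> (\<lambda>n. iter u n l) \<longlonglongrightarrow> v l"
    unfolding convergent_def by metis
  have lim: "uniform_limit {a..b} (iter u) v sequentially"
    using u v by (rule iter_uniform_limit_of_pointwise)
  have v_cont: "continuous_on {a..b} v"
    by (rule uniform_limit_theorem[OF _ lim]) (use sector_cont[OF iter_sector[OF u]] in auto)
  have v_bounds: "z0 l \<le> v l" "v l \<le> w0 l" if "l \<in> {a..b}" for l
    using tendsto_lowerbound[OF v[OF that], of "z0 l"] tendsto_upperbound[OF v[OF that], of "w0 l"] bounds[OF that]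
    by auto
  have v_sect: "v \<in> sect" using v_cont v_bounds by (simp add: sector_def)
  \<comment> \<open>The equation at \<open>l\<close> involves the values of a function on \<open>{a..b}\<close> only, so the pointwise limit
      \<open>v\<close> may be replaced by the solution of the linear problem frozen at \<open>v\<close>.\<close>
  define z where "z = step v"
  have z_sol: "sol (\<lambda>l _. F l (v l)) z" unfolding z_def using v_cont by (rule step)
  have F_lim: "uniform_limit {a..b} (\<lambda>n l. F l (iter u n l)) (\<lambda>l. F l (v l)) sequentially"
  proof -
    have "continuous_on {a..b} z0" "continuous_on {a..b} w0" using z0_sector w0_sector by (auto intro: sector_cont)
    then have "bounded (z0 ` {a..b} \<union> w0 ` {a..b})"
      by (auto intro!: compact_imp_bounded compact_continuous_image)
    then obtain R where R: "\<And>l. l \<in> {a..b} \<Longrightarrow> \<bar>z0 l\<bar> \<le> R" "\<And>l. l \<in> {a..b} \<Longrightarrow> \<bar>w0 l\<bar> \<le> R"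
      unfolding bounded_iff by (metis UnCI imageI real_norm_def)
    have in_R: "x \<in> {-R..R}" if "l \<in> {a..b}" "z0 l \<le> x" "x \<le> w0 l" for l x
      using R[OF that(1)] that by auto
    have "uniform_limit {a..b} (\<lambda>n l. (case (l, iter u n l) of (l, x) \<Rightarrow> F l x))
        ((\<lambda>(l, x). F l x) \<circ> (\<lambda>l. (l, v l))) sequentially"
    proof (rule uniform_limit_compose)
      show "uniform_limit {a..b} (\<lambda>n l. (l, iter u n l)) (\<lambda>l. (l, v l)) sequentially"
        using lim by (simp add: uniform_limit_iff dist_Pair_Pair)
      show "uniformly_continuous_on ({a..b} \<times> {-R..R}) (\<lambda>(l, x). F l x)"
        by (intro compact_uniformly_continuous compact_Times continuous_on_subset[OF F_cont]) auto
      show "\<forall>\<^sub>F n in sequentially. (\<lambda>l. (l, iter u n l)) ` {a..b} \<subseteq> {a..b} \<times> {-R..R}"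
      proof (intro always_eventually allI image_subsetI SigmaI)
        show "iter u n l \<in> {-R..R}" if l: "l \<in> {a..b}" for n l
          using l bounds[OF l] by (rule in_R)
      qed
      show "(\<lambda>l. (l, v l)) ` {a..b} \<subseteq> {a..b} \<times> {-R..R}"
      proof (intro image_subsetI SigmaI)
        show "v l \<in> {-R..R}" if l: "l \<in> {a..b}" for l
          using l v_bounds[OF l] by (rule in_R)
      qed
    qed
    then show ?thesis by (simp add: o_def)
  qed
  have zv: "z l = v l" if l: "l \<in> {a..b}" for l
  proof (rule LIMSEQ_unique)
    show "(\<lambda>n. iter u (Suc n) l) \<longlonglongrightarrow> v l" using v[OF l] by (rule LIMSEQ_Suc)
    have s: "sol (\<lambda>l _. F l (iter u n l)) (iter u (Suc n))" for n
      using step[OF sector_cont[OF iter_sector[OF u]]] by simp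
    show "(\<lambda>n. iter u (Suc n) l) \<longlonglongrightarrow> z l"
    proof (rule linear_problem_limit[OF _ _ _ _ l])
      show "adm (iter u (Suc n))" "iter u (Suc n) a = z a" for n
        using s[of n] z_sol by (auto simp: solution_def)
      show "adm z" using z_sol by (simp add: solution_def)
      show "uniform_limit {a..b} (\<lambda>n. L (iter u (Suc n))) (L z) sequentially"
        using F_lim s z_sol by (simp add: uniform_limit_iff solution_def)
    qed
  qed
  show ?thesis
  proof (rule that)
    show "z \<in> sect" unfolding z_def using v_sect by (rule step_sector)
    show "sol F z" using z_sol zv by (simp add: solution_def)
    show "uniform_limit {a..b} (iter u) z sequentially"
      using lim zv by (simp add: uniform_limit_iff)
  qed
qed

lemma iterates_converge_to_extremal_solutions:
  obtains zmin zmax where "extremal_solutions a b \<Phi> \<mu> \<kappa> \<omega> F za z0 w0 zmin zmax"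
    "uniform_limit {a..b} (iter z0) zmin sequentially"
    "uniform_limit {a..b} (iter w0) zmax sequentially"
proof -
  have "monoseq (\<lambda>n. iter z0 n l)" "monoseq (\<lambda>n. iter w0 n l)" if "l \<in> {a..b}" for l
    using iter_lower_incseq[OF that] iter_upper_decseq[OF that] by (auto simp: monoseq_iff)
  then obtain zmin zmax where zmin: "zmin \<in> sect" "sol F zmin" "uniform_limit {a..b} (iter z0) zmin sequentially"
    and zmax: "zmax \<in> sect" "sol F zmax" "uniform_limit {a..b} (iter w0) zmax sequentially"
    using iter_limit_solution[OF z0_sector] iter_limit_solution[OF w0_sector] by metis
  have "zmin l \<le> z l \<and> z l \<le> zmax l" if z: "z \<in> sect" "sol F z" and l: "l \<in> {a..b}" for z l
  proof
    have "iter z0 n l \<le> z l" for n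
      using iter_mono[OF z0_sector z(1) _ l, of n] sector_bounds[OF z(1)] iter_sol[OF z(2,1) l] by simp
    then show "zmin l \<le> z l"
      by (intro LIMSEQ_le_const2[OF tendsto_uniform_limitI[OF zmin(3) l]]) auto
    have "z l \<le> iter w0 n l" for n
      using iter_mono[OF z(1) w0_sector _ l, of n] sector_bounds[OF z(1)] iter_sol[OF z(2,1) l] by simp
    then show "z l \<le> zmax l"
      by (intro LIMSEQ_le_const[OF tendsto_uniform_limitI[OF zmax(3) l]]) auto
  qed
  then have "extremal_solutions a b \<Phi> \<mu> \<kappa> \<omega> F za z0 w0 zmin zmax"
    using zmin zmax by (simp add: extremal_solutions_def)
  then show ?thesis using zmin(3) zmax(3) by (rule that)
qed

text \<open>
  By the comparison principle \<open>0 \<le> z - y \<le> J \<mu> (L z - L y) \<le> M * J \<mu> (z - y)\<close>, and the Gronwall inequality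
  with the additive constant \<open>0\<close> makes the difference vanish.
\<close>
lemma lipschitz_sol_unique:
  assumes M: "0 \<le> M" "\<forall>l\<in>{a..b}. \<forall>x y. z0 l \<le> x \<and> x \<le> y \<and> y \<le> w0 l \<longrightarrow> F l y - F l x \<le> M * (y - x)"
    and y: "y \<in> sect" "sol F y" and z: "z \<in> sect" "sol F z"
    and le: "\<And>l. l \<in> {a..b} \<Longrightarrow> y l \<le> z l" and l: "l \<in> {a..b}"
  shows "y l = z l"
proof -
  obtain C where C: "\<And>h e. continuous_on {a..b} h \<Longrightarrow> 0 \<le> e \<Longrightarrow>
      \<forall>l\<in>{a..b}. h l \<le> e + M * J \<mu> h l \<Longrightarrow> \<forall>l\<in>{a..b}. h l \<le> C * e"
    using fractional_gronwall[OF orders(3,4) M(1)] by blast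
  let ?h = "\<lambda>l. z l - y l"
  have h: "continuous_on {a..b} ?h" using y z by (intro continuous_on_diff sector_cont)
  have adm: "adm y" "adm z" and init: "y a = z a" using y z by (simp_all add: solution_def)
  have F_diff: "L y s \<le> L z s" "L z s - L y s \<le> M * ?h s" if s: "s \<in> {a..b}" for s
  proof -
    have "z0 s \<le> y s \<and> y s \<le> z s \<and> z s \<le> w0 s"
      using sector_bounds[OF y(1) s] sector_bounds[OF z(1) s] le[OF s] by simp
    moreover have "L y s = F s (y s)" "L z s = F s (z s)" using y z s by (simp_all add: solution_def)
    ultimately show "L y s \<le> L z s" "L z s - L y s \<le> M * ?h s"
      using F_mono M(2) s by (metis, metis)
  qed
  have "\<forall>l\<in>{a..b}. ?h l \<le> C * 0"
  proof (rule C[OF h], simp, rule)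
    fix t assume t: "t \<in> {a..b}"
    have "?h t \<le> J \<mu> (\<lambda>s. L z s - L y s) t"
      using comparison(2)[OF adm _ F_diff(1) t init] init by simp
    also have "\<dots> \<le> J \<mu> (\<lambda>s. M * ?h s) t"
    proof (rule J_mono)
      show "continuous_on {a..b} (\<lambda>s. L z s - L y s)"
        by (rule continuous_on_diff[OF admissible_representation(4) admissible_representation(4)]) fact+
      show "continuous_on {a..b} (\<lambda>s. M * ?h s)" by (intro continuous_on_mult h continuous_on_const)
      show "L z s - L y s \<le> M * ?h s" if "s \<in> {a..t}" for s
        using that t by (intro F_diff(2)) auto
    qed (use orders t in auto)
    finally show "?h t \<le> 0 + M * J \<mu> ?h t" by (simp add: J_cmult)
  qed
  then have "z l - y l \<le> 0" using l by simp
  then show ?thesis using le[OF l] by simp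
qed

end

theorem theorem3:
  fixes a b \<mu> \<kappa> \<omega> za :: real
    and \<Phi> :: "real \<Rightarrow> real"
    and F :: "real \<Rightarrow> real \<Rightarrow> real"
    and z0 w0 :: "real \<Rightarrow> real"
  assumes "0 \<le> a" and "a < b"
    and "C1_on {a..b} \<Phi>" and "mono_on {a..b} \<Phi>"
    and "\<forall>l\<in>{a..b}. vector_derivative \<Phi> (at l within {a..b}) \<noteq> 0"
    and "0 < \<kappa>" and "\<kappa> < \<mu>" and "\<mu> \<le> 1" and "0 < \<omega>"
    and "continuous_on ({a..b} \<times> UNIV) (\<lambda>(l, x). F l x)"
    and "lower_solution a b \<Phi> \<mu> \<kappa> \<omega> F za z0"
    and "upper_solution a b \<Phi> \<mu> \<kappa> \<omega> F za w0"
    and "\<forall>l\<in>{a..b}. z0 l \<le> w0 l"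
    and "\<forall>l\<in>{a..b}. \<forall>x y. z0 l \<le> x \<and> x \<le> y \<and> y \<le> w0 l \<longrightarrow> F l x \<le> F l y"
  shows "(\<exists>z w zmin zmax.
            iterative_sequence a b \<Phi> \<mu> \<kappa> \<omega> F za z0 z \<and>
            iterative_sequence a b \<Phi> \<mu> \<kappa> \<omega> F za w0 w \<and>
            (\<forall>l\<in>{a..b}. incseq (\<lambda>n. z n l)) \<and>
            (\<forall>l\<in>{a..b}. decseq (\<lambda>n. w n l)) \<and>
            extremal_solutions a b \<Phi> \<mu> \<kappa> \<omega> F za z0 w0 zmin zmax \<and>
            uniform_limit {a..b} z zmin sequentially \<and>
            uniform_limit {a..b} w zmax sequentially)
       \<and> ((\<exists>M\<ge>0. \<forall>l\<in>{a..b}. \<forall>x y. z0 l \<le> x \<and> x \<le> y \<and> y \<le> w0 l \<longrightarrow>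
              0 \<le> F l y - F l x \<and> F l y - F l x \<le> M * (y - x)) \<longrightarrow>
          (\<exists>z \<in> sector a b z0 w0. solution a b \<Phi> \<mu> \<kappa> \<omega> F za z \<and>
             (\<forall>u \<in> sector a b z0 w0. solution a b \<Phi> \<mu> \<kappa> \<omega> F za u \<longrightarrow>
                (\<forall>l\<in>{a..b}. u l = z l))))"
proof -
  interpret sector_problem a b \<Phi> \<mu> \<kappa> \<omega> F za z0 w0
    using assms by unfold_locales auto
  obtain zmin zmax where ext: "extremal_solutions a b \<Phi> \<mu> \<kappa> \<omega> F za z0 w0 zmin zmax"
    and lim: "uniform_limit {a..b} (iter z0) zmin sequentially"
      "uniform_limit {a..b} (iter w0) zmax sequentially"
    by (rule iterates_converge_to_extremal_solutions)
  show ?thesis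
  proof (intro conjI impI)
    show "\<exists>z w zmin zmax.
            iterative_sequence a b \<Phi> \<mu> \<kappa> \<omega> F za z0 z \<and>
            iterative_sequence a b \<Phi> \<mu> \<kappa> \<omega> F za w0 w \<and>
            (\<forall>l\<in>{a..b}. incseq (\<lambda>n. z n l)) \<and>
            (\<forall>l\<in>{a..b}. decseq (\<lambda>n. w n l)) \<and>
            extremal_solutions a b \<Phi> \<mu> \<kappa> \<omega> F za z0 w0 zmin zmax \<and>
            uniform_limit {a..b} z zmin sequentially \<and>
            uniform_limit {a..b} w zmax sequentially"
      using iter_sequence[OF z0_sector] iter_sequence[OF w0_sector]
        iter_lower_incseq iter_upper_decseq ext lim by blast
  next
    assume "\<exists>M\<ge>0. \<forall>l\<in>{a..b}. \<forall>x y. z0 l \<le> x \<and> x \<le> y \<and> y \<le> w0 l \<longrightarrow>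
              0 \<le> F l y - F l x \<and> F l y - F l x \<le> M * (y - x)"
    then obtain M where M: "0 \<le> M"
      "\<forall>l\<in>{a..b}. \<forall>x y. z0 l \<le> x \<and> x \<le> y \<and> y \<le> w0 l \<longrightarrow> F l y - F l x \<le> M * (y - x)"
      by blast
    have zmin: "zmin \<in> sect" "sol F zmin"
      and min: "\<And>u l. u \<in> sect \<Longrightarrow> sol F u \<Longrightarrow> l \<in> {a..b} \<Longrightarrow> zmin l \<le> u l"
      using ext by (auto simp: extremal_solutions_def)
    have "\<forall>u\<in>sect. sol F u \<longrightarrow> (\<forall>l\<in>{a..b}. u l = zmin l)"
      using lipschitz_sol_unique[OF M zmin _ _ min] by simp
    with zmin show "\<exists>z\<in>sect. sol F z \<and> (\<forall>u\<in>sect. sol F u \<longrightarrow> (\<forall>l\<in>{a..b}. u l = z l))"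
      by blast
  qed
qed

end
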